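(* Let $\Omega\subset\mathbb C^n$ be a bounded open set and $1<q\le\infty$. Suppose that for every $\zeta\in\partial\Omega$ there exists $f_\zeta\in\bigcap_{p<q}\mathcal{O}L^p(\Omega)$ such that $f_\zeta\notin\mathcal{O}L^q(B(\zeta,\varepsilon)\cap\Omega)$ for every $\varepsilon>0$ and $\lim_{z\to\zeta,\,z\in\Omega}f_\zeta(z)=\infty$. Then the set $$\Big\{g\in\bigcap_{p<q}\mathcal{O}L^p(\Omega): g\text{ is totally unbounded in }\Omega\text{ and } g\notin\mathcal{O}L^q(B(\zeta,\varepsilon)\cap\Omega)\ \forall\zeta\in\partial\Omega,\ \forall\varepsilon>0\Big\}$$ is dense and $G_\delta$ in $\bigcap_{p<q}\mathcal{O}L^p(\Omega)$.
   Context: For an open bounded set $D$ and $p\ge1$, $\mathcal{O}L^p(D)$ is the space of holomorphic $f$ on $D$ with $\int_D|f|^p\,dv<\infty$; $\mathcal{O}L^\infty(D)$ is the space of bounded holomorphic functions on $D$. "$g\notin\mathcal{O}L^q(B(\zeta,\varepsilon)\cap\Omega)$" means the restriction of $g$ to $B(\zeta,\varepsilon)\cap\Omega$ is not in that space. For $1<q\le\infty$, $\bigcap_{p<q}\mathcal{O}L^p(\Omega)$ carries the complete metric $d(f,g)=\sum_j2^{-j}\frac{\|f-g\|_{p_j}}{1+\|f-g\|_{p_j}}$ with $1<p_1<p_2<\dots$, $p_j\to q$; convergence means $\|f_k-f\|_p\to0$ for all $p<q$. A holomorphic $f$ is totally unbounded in $\Omega$ if for every $w\in\partial\Omega$, $\delta>0$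 and every connected component $E$ of $B(w,\delta)\cap\Omega$, $\sup_E|f|=\infty$. *)

theory Defs
  imports "HOL-Analysis.Analysis"
begin

definition holo_on :: "(complex^'n \<Rightarrow> complex) \<Rightarrow> (complex^'n) set \<Rightarrow> bool" where
  "holo_on f D \<longleftrightarrow> (\<forall>z\<in>D. \<exists>L. (f has_derivative L) (at z) \<and> (\<forall>c v. L (c *s v) = c * L v))"

definition Lp_integral :: "real \<Rightarrow> (complex^'n) set \<Rightarrow> (complex^'n \<Rightarrow> complex) \<Rightarrow> ennreal" where
  "Lp_integral p D f = (\<integral>\<^sup>+ z\<in>D. ennreal (norm (f z) powr p) \<partial>lborel)"

definition OL :: "real \<Rightarrow> (complex^'n) set \<Rightarrow> (complex^'n \<Rightarrow> complex) \<Rightarrow> bool" where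
  "OL p D f \<longleftrightarrow> holo_on f D \<and> Lp_integral p D f < \<infinity>"

definition OL_inf :: "(complex^'n) set \<Rightarrow> (complex^'n \<Rightarrow> complex) \<Rightarrow> bool" where
  "OL_inf D f \<longleftrightarrow> holo_on f D \<and> bounded (f ` D)"

definition OLq :: "ereal \<Rightarrow> (complex^'n) set \<Rightarrow> (complex^'n \<Rightarrow> complex) \<Rightarrow> bool" where
  "OLq q D f \<longleftrightarrow> (if q = \<infinity> then OL_inf D f else OL (real_of_ereal q) D f)"

definition OL_below :: "ereal \<Rightarrow> (complex^'n) set \<Rightarrow> (complex^'n \<Rightarrow> complex) \<Rightarrow> bool" where
  "OL_below q D f \<longleftrightarrow> (\<forall>p::real. 1 \<le> p \<and> ereal p < q \<longrightarrow> OL p D f)"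

text \<open>The space (intersection over p<q of OL^p(Omega)); functions are considered on Omega
  only, normalised to be 0 outside Omega so that elements are identified with their
  restrictions to Omega.\<close>
definition OL_space :: "ereal \<Rightarrow> (complex^'n) set \<Rightarrow> (complex^'n \<Rightarrow> complex) set" where
  "OL_space q \<Omega> = {f. OL_below q \<Omega> f \<and> (\<forall>z. z \<notin> \<Omega> \<longrightarrow> f z = 0)}"

definition Lp_norm :: "real \<Rightarrow> (complex^'n) set \<Rightarrow> (complex^'n \<Rightarrow> complex) \<Rightarrow> real" where
  "Lp_norm p D f = enn2real (Lp_integral p D f) powr (1 / p)"

text \<open>The metric d(f,g) = sum_j 2^(-j) ||f-g||_{p_j} / (1 + ||f-g||_{p_j}), j = 1,2,...
  (here the sequence pj is indexed from 0, pj j playing the role of p_(j+1)).\<close>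
definition OL_dist :: "(nat \<Rightarrow> real) \<Rightarrow> (complex^'n) set
    \<Rightarrow> (complex^'n \<Rightarrow> complex) \<Rightarrow> (complex^'n \<Rightarrow> complex) \<Rightarrow> real" where
  "OL_dist pj \<Omega> f g = (\<Sum>j. (1/2) ^ (Suc j) *
      (Lp_norm (pj j) \<Omega> (\<lambda>z. f z - g z) / (1 + Lp_norm (pj j) \<Omega> (\<lambda>z. f z - g z))))"

definition totally_unbounded :: "(complex^'n \<Rightarrow> complex) \<Rightarrow> (complex^'n) set \<Rightarrow> bool" where
  "totally_unbounded f \<Omega> \<longleftrightarrow>
     (\<forall>w\<in>frontier \<Omega>. \<forall>\<delta>>0. \<forall>E\<in>components (ball w \<delta> \<inter> \<Omega>). \<not> bounded (f ` E))"

end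

theory Submission
  imports Defs "HOL-Complex_Analysis.Cauchy_Integral_Formula"
begin

text \<open>The two requirements on \<open>g\<close> at the boundary amount to countably many conditions "\<open>g\<close> is not of
  class \<open>L\<^sup>r\<close> on \<open>D\<close>", where \<open>B\<close> runs through a countable base of balls centred at boundary points
  and either \<open>r = \<infinity>\<close> and \<open>D\<close> is a component of \<open>B \<inter> \<Omega>\<close>, or \<open>r = q\<close> and \<open>D = B \<inter> \<Omega>\<close>. By Fatou's
  lemma, the functions of class \<open>L\<^sup>r\<close> on \<open>D\<close> form a countable union of closed sets. These have
  empty interior: \<open>D\<close> accumulates at some boundary point \<open>\<zeta>\<close> for which \<open>f\<^sub>\<zeta>\<close> is not of class \<open>L\<^sup>r\<close> on
  \<open>D\<close>, and if \<open>g\<close> is of class \<open>L\<^sup>r\<close> on \<open>D\<close>, then \<open>g + s f\<^sub>\<zeta>\<close> is not for any \<open>s \<noteq> 0\<close>. The mean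
  value inequality turns convergence in the metric into locally uniform convergence, so that the space
  is complete and Baire's theorem applies.\<close>

section \<open>Holomorphic functions of several variables\<close>

lemma norm_vector_scalar_mult: "norm (c *s v) = norm c * norm v"
  for v :: "complex^'n"
  by (simp add: norm_vec_def L2_set_def norm_mult power_mult_distrib sum_distrib_left [symmetric]
      real_sqrt_mult)

lemma bounded_bilinear_vector_scalar_mult:
  "bounded_bilinear ((*s) :: complex \<Rightarrow> complex^'n \<Rightarrow> complex^'n)"
  by unfold_locales
    (auto simp: vec_eq_iff algebra_simps norm_vector_scalar_mult intro!: exI[of _ 1])

lemma holo_onE:
  assumes "holo_on f D" "z \<in> D"
  obtains L where "(f has_derivative L) (at z)" "\<And>c v. L (c *s v) = c * L v"
  using assms unfolding holo_on_def by blast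

lemma holo_on_subset: "holo_on f D \<Longrightarrow> E \<subseteq> D \<Longrightarrow> holo_on f E"
  unfolding holo_on_def by blast

lemma holo_on_imp_continuous_on: "holo_on f D \<Longrightarrow> continuous_on D f"
  by (meson continuous_at_imp_continuous_on has_derivative_continuous holo_onE)

lemma holo_on_add:
  assumes "holo_on f D" "holo_on g D"
  shows "holo_on (\<lambda>z. f z + g z) D"
  unfolding holo_on_def
proof
  fix z assume z_in_D: "z \<in> D"
  obtain L M where "(f has_derivative L) (at z)" "\<And>c v. L (c *s v) = c * L v"
    and "(g has_derivative M) (at z)" "\<And>c v. M (c *s v) = c * M v"
    using holo_onE[OF assms(1) z_in_D] holo_onE[OF assms(2) z_in_D] by metis
  then show "\<exists>L. ((\<lambda>z. f z + g z) has_derivative L) (at z) \<and> (\<forall>c v. L (c *s v) = c * L v)"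
    by (intro exI[of _ "\<lambda>v. L v + M v"] conjI has_derivative_add) (simp_all add: algebra_simps)
qed

lemma holo_on_cmult:
  assumes "holo_on f D"
  shows "holo_on (\<lambda>z. a * f z) D"
  unfolding holo_on_def
proof
  fix z assume z_in_D: "z \<in> D"
  obtain L where "(f has_derivative L) (at z)" "\<And>c v. L (c *s v) = c * L v"
    using holo_onE[OF assms z_in_D] by metis
  then show "\<exists>L. ((\<lambda>z. a * f z) has_derivative L) (at z) \<and> (\<forall>c v. L (c *s v) = c * L v)"
    by (intro exI[of _ "\<lambda>v. a * L v"] conjI has_derivative_mult_right) (simp_all add: algebra_simps)
qed

lemma holo_on_diff: "holo_on f D \<Longrightarrow> holo_on g D \<Longrightarrow> holo_on (\<lambda>z. f z - g z) D"
  using holo_on_add[of f D "\<lambda>z. -1 * g z"] holo_on_cmult[of g D "-1"] by simp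

lemma holo_on_transform:
  assumes "open D" "holo_on f D" "\<And>z. z \<in> D \<Longrightarrow> f z = g z"
  shows "holo_on g D"
  using assms unfolding holo_on_def by (meson has_derivative_transform_within_open)

lemma holo_on_cong:
  assumes "open D" "\<And>z. z \<in> D \<Longrightarrow> f z = g z"
  shows "holo_on f D \<longleftrightarrow> holo_on g D"
  using holo_on_transform[of D f g] holo_on_transform[of D g f] assms by metis

lemma has_field_derivative_along_complex_line:
  fixes f :: "complex^'n \<Rightarrow> complex"
  assumes "(f has_derivative L) (at (z + w *s v))" and complex_linear: "\<And>c u. L (c *s u) = c * L u"
  shows "((\<lambda>w. f (z + w *s v)) has_field_derivative L v) (at w)"
proof -
  interpret bounded_linear "\<lambda>w. w *s v"
    using bounded_bilinear_vector_scalar_mult by (rule bounded_bilinear.bounded_linear_left)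
  have "((\<lambda>w. z + w *s v) has_derivative (\<lambda>w. w *s v)) (at w)"
    using has_derivative_add[OF has_derivative_const
        bounded_linear_imp_has_derivative[OF bounded_linear_axioms]] by simp
  from has_derivative_compose[OF this assms(1)] show ?thesis
    by (simp add: has_field_derivative_def complex_linear mult.commute[of _ "L v"])
qed

lemma holomorphic_along_complex_line:
  assumes "holo_on f D" "\<And>w. w \<in> S \<Longrightarrow> z + w *s v \<in> D"
  shows "(\<lambda>w. f (z + w *s v)) holomorphic_on S"
  unfolding holomorphic_on_def field_differentiable_def
proof
  fix w assume "w \<in> S"
  with assms obtain L where "(f has_derivative L) (at (z + w *s v))" "\<And>c u. L (c *s u) = c * L u"
    using holo_onE by blast
  then have "((\<lambda>w. f (z + w *s v)) has_field_derivative L v) (at w)"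
    by (rule has_field_derivative_along_complex_line)
  then show "\<exists>d. ((\<lambda>w. f (z + w *s v)) has_field_derivative d) (at w within S)"
    using has_field_derivative_at_within by blast
qed

lemma holo_on_derivative_bound:
  assumes holo: "holo_on f (cball z r)" and "0 < r"
    and bound: "\<And>w. w \<in> cball z r \<Longrightarrow> norm (f w) \<le> B"
    and derivative: "(f has_derivative L) (at z)" "\<And>c v. L (c *s v) = c * L v"
  shows "norm (L h) \<le> B / r * norm h"
proof (cases "h = 0")
  case True
  then show ?thesis using derivative(2)[of 0 0] by simp
next
  case False
  define v where "v = (of_real (1 / norm h) :: complex) *s h"
  define \<phi> where "\<phi> = (\<lambda>w. f (z + w *s v))"
  have "norm v = 1"
    using False by (simp add: v_def norm_vector_scalar_mult norm_divide)
  then have line: "z + w *s v \<in> cball z r" if "w \<in> cball 0 r" for w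
    using that by (simp add: dist_norm norm_vector_scalar_mult)
  then have holo_\<phi>: "\<phi> holomorphic_on cball 0 r"
    unfolding \<phi>_def by (rule holomorphic_along_complex_line[OF holo])
  have "norm ((deriv ^^ 1) \<phi> 0) \<le> fact 1 * B / r ^ 1"
    using \<open>0 < r\<close> bound line holomorphic_on_subset[OF holo_\<phi> ball_subset_cball]
    by (intro Cauchy_inequality holomorphic_on_imp_continuous_on holo_\<phi>) (auto simp: \<phi>_def)
  moreover have "deriv \<phi> 0 = L v"
    unfolding \<phi>_def
    by (intro DERIV_imp_deriv has_field_derivative_along_complex_line) (simp_all add: derivative)
  ultimately have "norm (L v) \<le> B / r" by simp
  moreover have "L h = of_real (norm h) * L v"
    unfolding v_def derivative(2) using False by simp
  ultimately show ?thesis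
    using mult_right_mono[of "norm (L v)" "B / r" "norm h"] by (simp add: norm_mult mult.commute)
qed

lemma has_derivative_limit_of_uniformly_Cauchy_derivatives:
  fixes f :: "nat \<Rightarrow> 'a::real_normed_vector \<Rightarrow> 'b::banach"
  assumes "convex S"
    and deriv: "\<And>n x. x \<in> S \<Longrightarrow> (f n has_derivative f' n x) (at x within S)"
    and Cauchy_f': "\<And>e. 0 < e \<Longrightarrow>
      \<exists>N. \<forall>m\<ge>N. \<forall>n\<ge>N. \<forall>x\<in>S. \<forall>h. norm (f' m x h - f' n x h) \<le> e * norm h"
    and lim: "\<And>x. x \<in> S \<Longrightarrow> (\<lambda>n. f n x) \<longlonglongrightarrow> g x"
  obtains g' where "\<And>x. x \<in> S \<Longrightarrow> (g has_derivative g' x) (at x within S)"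
    "\<And>x h. x \<in> S \<Longrightarrow> (\<lambda>n. f' n x h) \<longlonglongrightarrow> g' x h"
proof (cases "S = {}")
  case False
  then obtain x0 where "x0 \<in> S" by blast
  have "Cauchy (\<lambda>n. f' n x h)" if "x \<in> S" for x h
  proof (rule metric_CauchyI)
    fix e :: real assume "0 < e"
    then have pos: "0 < e / (norm h + 1)" by (simp add: add_nonneg_pos)
    have "e / (norm h + 1) * norm h < e"
      using \<open>0 < e\<close> by (simp add: divide_simps add_nonneg_pos)
    then show "\<exists>N. \<forall>m\<ge>N. \<forall>n\<ge>N. dist (f' m x h) (f' n x h) < e"
      using Cauchy_f'[OF pos] \<open>x \<in> S\<close> unfolding dist_norm by (meson le_less_trans)
  qed
  then have "\<forall>x h. \<exists>l. x \<in> S \<longrightarrow> (\<lambda>n. f' n x h) \<longlonglongrightarrow> l"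
    using Cauchy_convergent_iff convergent_def by metis
  then obtain g' where f'_lim: "\<And>x h. x \<in> S \<Longrightarrow> (\<lambda>n. f' n x h) \<longlonglongrightarrow> g' x h"
    by metis
  have "\<forall>\<^sub>F n in sequentially. \<forall>x\<in>S. \<forall>h. norm (f' n x h - g' x h) \<le> e * norm h"
    if "0 < e" for e :: real
  proof -
    obtain N where close_after_N: "\<forall>m\<ge>N. \<forall>n\<ge>N. \<forall>x\<in>S. \<forall>h. norm (f' m x h - f' n x h) \<le> e * norm h"
      using Cauchy_f'[OF \<open>0 < e\<close>] by blast
    have "norm (f' n x h - g' x h) \<le> e * norm h" if "N \<le> n" "x \<in> S" for n x h
    proof (rule tendsto_upperbound)
      show "(\<lambda>m. norm (f' n x h - f' m x h)) \<longlonglongrightarrow> norm (f' n x h - g' x h)"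
        by (intro tendsto_intros f'_lim \<open>x \<in> S\<close>)
      show "\<forall>\<^sub>F m in sequentially. norm (f' n x h - f' m x h) \<le> e * norm h"
        by (rule eventually_sequentiallyI[of N]) (use close_after_N that in blast)
    qed simp
    then show ?thesis by (intro eventually_sequentiallyI[of N] ballI allI)
  qed
  from has_derivative_sequence[OF \<open>convex S\<close> deriv this \<open>x0 \<in> S\<close> lim[OF \<open>x0 \<in> S\<close>]]
  obtain h where limit_deriv: "\<And>x. x \<in> S \<Longrightarrow> (\<lambda>n. f n x) \<longlonglongrightarrow> h x"
      "\<And>x. x \<in> S \<Longrightarrow> (h has_derivative g' x) (at x within S)"
    by blast
  have "h x = g x" if "x \<in> S" for x
    using LIMSEQ_unique limit_deriv(1) lim that by blast
  then have "(g has_derivative g' x) (at x within S)" if "x \<in> S" for x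
    using has_derivative_transform[OF that _ limit_deriv(2)[OF that]] by metis
  then show ?thesis using that f'_lim by blast
qed (use that in blast)

lemma uniform_limit_imp_uniformly_Cauchy_derivatives:
  fixes f :: "nat \<Rightarrow> complex^'n \<Rightarrow> complex"
  assumes "0 < r" "0 < e"
    and holo: "\<And>n. holo_on (f n) (cball z0 r)"
    and unif: "uniform_limit (cball z0 r) f g sequentially"
    and derivatives: "\<And>n z. z \<in> cball z0 r \<Longrightarrow> (f n has_derivative L n z) (at z)"
      "\<And>n z c v. z \<in> cball z0 r \<Longrightarrow> L n z (c *s v) = c * L n z v"
  shows "\<exists>N. \<forall>m\<ge>N. \<forall>n\<ge>N. \<forall>z\<in>ball z0 (r / 2). \<forall>h. norm (L m z h - L n z h) \<le> e * norm h"
proof -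
  have "0 < e * r / 4" using assms by simp
  then obtain N where close_after_N: "\<And>n w. n \<ge> N \<Longrightarrow> w \<in> cball z0 r \<Longrightarrow> norm (f n w - g w) < e * r / 4"
    using uniform_limitD[OF unif] unfolding eventually_sequentially dist_norm by metis
  have "norm (L m z h - L n z h) \<le> e * r / 2 / (r / 2) * norm h"
    if "m \<ge> N" "n \<ge> N" "z \<in> ball z0 (r / 2)" for m n z h
  proof (rule holo_on_derivative_bound[where f = "\<lambda>w. f m w - f n w" and z = z])
    have cball_sub: "cball z (r / 2) \<subseteq> cball z0 r"
      using that(3) by (auto simp: subset_iff intro: order_trans[OF dist_triangle[of z0 _ z]])
    then show "holo_on (\<lambda>w. f m w - f n w) (cball z (r / 2))"
      using holo_on_diff[OF holo holo] holo_on_subset by blast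
    have "z \<in> cball z0 r" using that(3) \<open>0 < r\<close> by simp
    then show "((\<lambda>w. f m w - f n w) has_derivative (\<lambda>h. L m z h - L n z h)) (at z)"
      and "\<And>c v. L m z (c *s v) - L n z (c *s v) = c * (L m z v - L n z v)"
      by (simp_all add: derivatives has_derivative_diff right_diff_distrib)
    fix w assume "w \<in> cball z (r / 2)"
    then have "norm (f m w - g w) < e * r / 4" "norm (f n w - g w) < e * r / 4"
      using close_after_N that cball_sub by blast+
    then show "norm (f m w - f n w) \<le> e * r / 2"
      using norm_triangle_ineq4[of "f m w - g w" "f n w - g w"] by simp
  qed (use \<open>0 < r\<close> in simp)
  then show ?thesis using \<open>0 < r\<close> by (intro exI[of _ N]) simp
qed

lemma holo_on_uniform_limit:
  fixes f :: "nat \<Rightarrow> complex^'n \<Rightarrow> complex"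
  assumes holo: "\<And>n. holo_on (f n) D"
    and lim: "\<And>z. z \<in> D \<Longrightarrow> \<exists>r>0. cball z r \<subseteq> D \<and> uniform_limit (cball z r) f g sequentially"
  shows "holo_on g D"
  unfolding holo_on_def
proof
  fix z0 assume "z0 \<in> D"
  then obtain r where ball_in_D: "0 < r" "cball z0 r \<subseteq> D"
    and unif: "uniform_limit (cball z0 r) f g sequentially"
    using lim by blast
  define S where "S = ball z0 (r / 2)"
  have small_ball: "S \<subseteq> cball z0 r" "z0 \<in> S" "open S" "convex S"
    using ball_in_D by (auto simp: S_def)
  have "\<forall>n z. \<exists>L. z \<in> D \<longrightarrow> (f n has_derivative L) (at z) \<and> (\<forall>c v. L (c *s v) = c * L v)"
    using holo unfolding holo_on_def by blast
  then obtain L where derivatives: "\<And>n z. z \<in> D \<Longrightarrow> (f n has_derivative L n z) (at z)"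
      "\<And>n z c v. z \<in> D \<Longrightarrow> L n z (c *s v) = c * L n z v"
    by metis
  have Cauchy_derivatives: "\<exists>N. \<forall>m\<ge>N. \<forall>n\<ge>N. \<forall>z\<in>S. \<forall>h. norm (L m z h - L n z h) \<le> e * norm h"
    if "0 < e" for e
    unfolding S_def
  proof (rule uniform_limit_imp_uniformly_Cauchy_derivatives[where f = f and g = g])
    show "holo_on (f n) (cball z0 r)" for n using holo ball_in_D(2) by (rule holo_on_subset)
  qed (use ball_in_D derivatives unif that in \<open>simp_all add: subset_iff\<close>)
  have derivatives_within: "(f n has_derivative L n z) (at z within S)" if "z \<in> S" for n z
    using derivatives(1) small_ball(1) ball_in_D(2) that has_derivative_at_withinI by blast
  have f_lim: "(\<lambda>n. f n z) \<longlonglongrightarrow> g z" if "z \<in> S" for z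
    using tendsto_uniform_limitI[OF unif] small_ball(1) that by blast
  obtain G where limit_derivative: "\<And>z. z \<in> S \<Longrightarrow> (g has_derivative G z) (at z within S)"
      "\<And>z h. z \<in> S \<Longrightarrow> (\<lambda>n. L n z h) \<longlonglongrightarrow> G z h"
    using has_derivative_limit_of_uniformly_Cauchy_derivatives
      [OF small_ball(4) derivatives_within Cauchy_derivatives f_lim] by metis
  have "(g has_derivative G z0) (at z0)"
    using limit_derivative(1)[OF small_ball(2)] at_within_open[OF small_ball(2,3)] by simp
  moreover have "G z0 (c *s v) = c * G z0 v" for c v
  proof (rule LIMSEQ_unique[OF limit_derivative(2)[OF small_ball(2)]])
    show "(\<lambda>n. L n z0 (c *s v)) \<longlonglongrightarrow> c * G z0 v"
      using limit_derivative(2)[OF small_ball(2)] \<open>z0 \<in> D\<close>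
      by (simp add: derivatives(2) tendsto_mult_left)
  qed
  ultimately show "\<exists>L. (g has_derivative L) (at z0) \<and> (\<forall>c v. L (c *s v) = c * L v)" by blast
qed

section \<open>The mean value inequality\<close>

lemma nn_integral_lborel_translate:
  fixes u :: "'a::euclidean_space \<Rightarrow> ennreal"
  assumes [measurable]: "u \<in> borel_measurable borel"
  shows "(\<integral>\<^sup>+ x. u (a + x) \<partial>lborel) = (\<integral>\<^sup>+ x. u x \<partial>lborel)"
  by (subst (2) lborel_distr_plus[of a, symmetric]) (simp add: nn_integral_distr)

text \<open>The classical proof of the uniqueness of Haar measure: Fubini's theorem and translation
  invariance compare the two measures on an arbitrary set with those on a ball.\<close>

lemma distr_lborel_orthogonal_transformation:
  fixes f :: "'a::euclidean_space \<Rightarrow> 'a"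
  assumes f: "orthogonal_transformation f"
  shows "distr lborel borel f = lborel"
proof (rule measure_eqI)
  fix A assume "A \<in> sets (distr lborel borel f)"
  then have [measurable]: "A \<in> sets borel" by simp
  have [measurable]: "f \<in> borel_measurable borel"
    using orthogonal_transformation_linear[OF f]
    by (intro borel_measurable_continuous_onI linear_continuous_on)
      (simp add: linear_conv_bounded_linear)
  define B where "B = ball (0::'a) 1"
  have [measurable]: "B \<in> sets borel" by (simp add: B_def)
  have ball_measure: "emeasure lborel B \<noteq> 0" "emeasure lborel B \<noteq> \<infinity>"
    using emeasure_lborel_ball_finite[of "0::'a" 1] content_ball_pos[of 1 "0::'a"]
    by (auto simp: B_def measure_def)
  have "emeasure (distr lborel borel f) A * emeasure lborel B
      = (\<integral>\<^sup>+ x. indicator A (f x) * emeasure lborel B \<partial>lborel)"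
    using nn_integral_distr[of f lborel borel "indicator A"] by (simp add: nn_integral_multc)
  also have "\<dots> = (\<integral>\<^sup>+ x. \<integral>\<^sup>+ y. indicator A (f x) * indicator B (y - f x) \<partial>lborel \<partial>lborel)"
    using nn_integral_lborel_translate[of "indicator B" "- f x" for x]
    by (simp add: nn_integral_cmult)
  also have "\<dots> = (\<integral>\<^sup>+ y. \<integral>\<^sup>+ x. indicator A (f x) * indicator B (y - f x) \<partial>lborel \<partial>lborel)"
    by (rule lborel_pair.Fubini'[symmetric]) measurable
  also have "\<dots> = (\<integral>\<^sup>+ y. \<integral>\<^sup>+ x. indicator B x * indicator A (f x + y) \<partial>lborel \<partial>lborel)"
  proof (rule nn_integral_cong)
    fix y
    obtain y' where "y = f y'"
      using orthogonal_transformation_surj[OF f] by (rule surjE)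
    then have "indicator A (f (y' + x)) * indicator B (y - f (y' + x))
        = (indicator B x * indicator A (f x + y) :: ennreal)" for x
      by (simp add: linear_add[OF orthogonal_transformation_linear[OF f]] B_def indicator_def
          orthogonal_transformation_norm[OF f] add.commute)
    then show "(\<integral>\<^sup>+ x. indicator A (f x) * indicator B (y - f x) \<partial>lborel)
        = (\<integral>\<^sup>+ x. indicator B x * indicator A (f x + y) \<partial>lborel)"
      using nn_integral_lborel_translate[of "\<lambda>x. indicator A (f x) * indicator B (y - f x)" y']
      by simp
  qed
  also have "\<dots> = (\<integral>\<^sup>+ x. \<integral>\<^sup>+ y. indicator B x * indicator A (f x + y) \<partial>lborel \<partial>lborel)"
    by (rule lborel_pair.Fubini') measurable
  also have "\<dots> = emeasure lborel A * emeasure lborel B"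
    using nn_integral_lborel_translate[of "indicator A"]
    by (simp add: nn_integral_cmult nn_integral_multc mult.commute)
  finally show "emeasure (distr lborel borel f) A = emeasure lborel A"
    using ball_measure by (simp add: ennreal_mult_cancel_left mult.commute[of _ "emeasure lborel B"])
qed simp

lemma powr_eq_mult_powr_minus_1: "0 < x \<Longrightarrow> x powr p = x * x powr (p - 1)" for x p :: real
  using powr_mult_base[of x "p - 1"] by simp

lemma powr_ge_tangent:
  fixes x a p :: real
  assumes "1 \<le> p" "0 \<le> x" "0 < a"
  shows "a powr p + p * a powr (p - 1) * (x - a) \<le> x powr p"
proof (cases "x = 0")
  case True
  then show ?thesis
    using assms powr_eq_mult_powr_minus_1[of a p] by simp
next
  case False
  have "((\<lambda>x. x powr p) has_field_derivative p * a powr (p - 1)) (at a within {0<..})"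
    using assms by (auto intro!: derivative_eq_intros)
  from convex_on_imp_above_tangent[OF powr_convex[OF \<open>1 \<le> p\<close>] _ _ _ this, of x]
  show ?thesis using False assms by (simp add: interior_open)
qed

lemma powr_le_integral_powr:
  fixes h :: "real \<Rightarrow> real"
  assumes cont: "continuous_on {0..1} h" and nonneg: "\<And>t. 0 \<le> h t"
    and mean: "a \<le> integral {0..1} h" and "0 \<le> a" "1 \<le> p"
  shows "a powr p \<le> integral {0..1} (\<lambda>t. h t powr p)"
proof -
  have cont_powr: "continuous_on {0..1} (\<lambda>t. h t powr p)"
    using cont nonneg \<open>1 \<le> p\<close> by (intro continuous_on_powr' continuous_intros) auto
  show ?thesis
  proof (cases "a = 0")
    case True
    then show ?thesis
      using cont_powr by (simp add: integral_nonneg integrable_continuous_real)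
  next
    case False
    have "a powr p \<le> a powr p + p * a powr (p - 1) * (integral {0..1} h - a)"
      using mean \<open>1 \<le> p\<close> by simp
    also have "\<dots> = integral {0..1} (\<lambda>t. a powr p + p * a powr (p - 1) * (h t - a))"
      using cont
      by (simp add: integral_add integral_diff integrable_continuous_real algebra_simps
          continuous_intros)
    also have "\<dots> \<le> integral {0..1} (\<lambda>t. h t powr p)"
      using False assms
      by (intro integral_le integrable_continuous_real[OF cont_powr] integrable_continuous_real
          continuous_intros powr_ge_tangent) auto
    finally show ?thesis .
  qed
qed

lemma has_integral_circle_mean:
  assumes holo: "\<phi> holomorphic_on cball z r" and "0 < r"
  shows "((\<lambda>t. \<phi> (circlepath z r t)) has_integral \<phi> z) {0..1}"
proof -
  let ?c = "2 * of_real pi * \<i>"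
  have "((\<lambda>t. ?c * \<phi> (circlepath z r t)) has_integral ?c * \<phi> z) {0..1}"
  proof (rule has_integral_eq)
    show "((\<lambda>t. \<phi> (circlepath z r t) / (circlepath z r t - z)
        * vector_derivative (circlepath z r) (at t)) has_integral ?c * \<phi> z) {0..1}"
      using holo \<open>0 < r\<close>
      by (intro Cauchy_integral_circlepath[unfolded has_contour_integral])
        (auto intro: holomorphic_on_imp_continuous_on holomorphic_on_subset)
  qed (use \<open>0 < r\<close> in \<open>simp add: vector_derivative_circlepath\<close>, simp add: circlepath)
  from has_integral_mult_right[OF this, of "1 / ?c"] show ?thesis by simp
qed

lemma powr_norm_le_circle_mean:
  assumes holo: "\<phi> holomorphic_on cball z r" and "0 < r" "1 \<le> p"
  shows "ennreal (norm (\<phi> z) powr p)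
    \<le> (\<integral>\<^sup>+ t. ennreal (norm (\<phi> (circlepath z r t)) powr p) * indicator {0..1} t \<partial>lborel)"
proof -
  define h where "h = (\<lambda>t. norm (\<phi> (circlepath z r t)))"
  have "circlepath z r ` {0..1} \<subseteq> cball z r"
    using \<open>0 < r\<close> by (auto simp: circlepath dist_norm norm_mult)
  then have "continuous_on {0..1} (\<lambda>t. \<phi> (circlepath z r t))"
    by (intro continuous_on_compose2[OF holomorphic_on_imp_continuous_on[OF holo]])
      (auto simp: circlepath intro!: continuous_intros)
  then have cont: "continuous_on {0..1} h" and cont_powr: "continuous_on {0..1} (\<lambda>t. h t powr p)"
    using \<open>1 \<le> p\<close> by (auto simp: h_def intro!: continuous_on_norm continuous_on_powr')
  have "norm (\<phi> z) \<le> integral {0..1} h"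
    using has_integral_circle_mean[OF holo \<open>0 < r\<close>] integrable_continuous_real[OF cont]
    unfolding h_def by (metis has_integral_iff integral_norm_bound_integral order_refl)
  then have "ennreal (norm (\<phi> z) powr p) \<le> ennreal (integral {0..1} (\<lambda>t. h t powr p))"
    using cont \<open>1 \<le> p\<close> by (intro ennreal_leI powr_le_integral_powr) (auto simp: h_def)
  also have "\<dots> = (\<integral>\<^sup>+ t. ennreal (h t powr p) * indicator {0..1} t \<partial>lborel)"
    using nn_integral_has_integral_lebesgue[OF _
        integrable_integral[OF integrable_continuous_real[OF cont_powr]]]
    by (simp add: mult.commute ennreal_mult' ennreal_indicator)
  finally show ?thesis
    by (simp add: h_def)
qed

lemma nn_integral_lborel_rotate:
  fixes u :: "complex^'n \<Rightarrow> ennreal"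
  assumes "norm c = 1" and [measurable]: "u \<in> borel_measurable borel"
  shows "(\<integral>\<^sup>+ v. u (z + c *s v) \<partial>lborel) = (\<integral>\<^sup>+ v. u v \<partial>lborel)"
proof -
  define rot where "rot = (\<lambda>v :: complex^'n. c *s v)"
  have "bounded_linear rot"
    unfolding rot_def using bounded_bilinear_vector_scalar_mult
    by (rule bounded_bilinear.bounded_linear_right)
  then have [measurable]: "rot \<in> borel_measurable borel"
    by (intro borel_measurable_continuous_onI linear_continuous_on)
  have "orthogonal_transformation rot"
    using \<open>bounded_linear rot\<close> \<open>norm c = 1\<close>
    by (simp add: orthogonal_transformation bounded_linear.linear rot_def norm_vector_scalar_mult)
  then have "distr lborel borel rot = lborel"
    by (rule distr_lborel_orthogonal_transformation)
  then have "(\<integral>\<^sup>+ v. u (z + v) \<partial>lborel) = (\<integral>\<^sup>+ v. u (z + v) \<partial>distr lborel borel rot)"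
    by simp
  also have "\<dots> = (\<integral>\<^sup>+ v. u (z + rot v) \<partial>lborel)"
    by (rule nn_integral_distr) measurable
  finally show ?thesis by (simp add: rot_def nn_integral_lborel_translate)
qed

lemma powr_norm_le_complex_circle_mean:
  fixes f :: "complex^'n \<Rightarrow> complex"
  assumes holo: "holo_on f D" and disc: "cball z (norm v) \<subseteq> D" and "1 \<le> p"
  shows "ennreal (norm (f z) powr p)
    \<le> (\<integral>\<^sup>+ t. ennreal (norm (f (z + circlepath 0 1 t *s v)) powr p) * indicator {0..1} t \<partial>lborel)"
proof -
  have "(\<lambda>w. f (z + w *s v)) holomorphic_on cball 0 1"
    using disc by (intro holomorphic_along_complex_line[OF holo])
      (auto simp: subset_iff dist_norm norm_vector_scalar_mult mult_left_le_one_le)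
  from powr_norm_le_circle_mean[OF this zero_less_one \<open>1 \<le> p\<close>] show ?thesis by simp
qed

lemma holo_on_imp_set_borel_measurable:
  "open D \<Longrightarrow> holo_on f D \<Longrightarrow> set_borel_measurable borel D f"
  unfolding set_borel_measurable_def
  by (intro borel_measurable_continuous_on_indicator holo_on_imp_continuous_on) auto

lemma borel_measurable_powr_norm_indicator [measurable]:
  assumes [measurable]: "set_borel_measurable borel D f"
  shows "(\<lambda>z. ennreal (norm (f z) powr p) * indicator D z) \<in> borel_measurable borel"
proof -
  have "(\<lambda>z. ennreal (norm (indicator D z *\<^sub>R f z) powr p)) \<in> borel_measurable borel"
    using assms unfolding set_borel_measurable_def by measurable
  also have "(\<lambda>z. ennreal (norm (indicator D z *\<^sub>R f z) powr p))
      = (\<lambda>z. ennreal (norm (f z) powr p) * indicator D z)"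
    by (auto simp: indicator_def)
  finally show ?thesis .
qed

lemma powr_norm_le_ball_mean:
  fixes f :: "complex^'n \<Rightarrow> complex"
  assumes holo: "holo_on f (ball z r)" and "1 \<le> p"
  shows "ennreal (norm (f z) powr p) * emeasure lborel (ball 0 r :: (complex^'n) set)
    \<le> Lp_integral p (ball z r) f"
proof -
  define u where "u = (\<lambda>w. ennreal (norm (f w) powr p) * indicator (ball z r) w)"
  have [measurable]: "u \<in> borel_measurable borel"
    unfolding u_def
    by (intro borel_measurable_powr_norm_indicator holo_on_imp_set_borel_measurable holo open_ball)
  have "continuous_on UNIV (\<lambda>(w, t). z + circlepath 0 1 t *s (w :: complex^'n))"
    unfolding circlepath case_prod_unfold
    by (intro continuous_intros
        bounded_bilinear.continuous_on[OF bounded_bilinear_vector_scalar_mult])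
  then have [measurable]:
    "(\<lambda>(w :: complex^'n, t). z + circlepath 0 1 t *s w) \<in> borel_measurable (borel \<Otimes>\<^sub>M borel)"
    by (subst borel_prod) (rule borel_measurable_continuous_onI)
  have norm_circle: "norm (circlepath 0 1 t) = 1" for t
    by (simp add: circlepath)
  have circle: "ennreal (norm (f z) powr p) * indicator (ball 0 r) w
      \<le> (\<integral>\<^sup>+ t. u (z + circlepath 0 1 t *s w) * indicator {0..1} t \<partial>lborel)" for w
  proof (cases "w \<in> ball 0 r")
    case True
    then have "cball z (norm w) \<subseteq> ball z r" by auto
    from powr_norm_le_complex_circle_mean[OF holo this \<open>1 \<le> p\<close>]
    show ?thesis
      using True norm_circle by (simp add: u_def dist_norm norm_vector_scalar_mult)
  qed simp
  have "ennreal (norm (f z) powr p) * emeasure lborel (ball 0 r :: (complex^'n) set)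
     = (\<integral>\<^sup>+ w. ennreal (norm (f z) powr p) * indicator (ball 0 r) (w :: complex^'n) \<partial>lborel)"
    by (rule nn_integral_cmult_indicator[symmetric]) simp
  also have "\<dots> \<le> (\<integral>\<^sup>+ w. \<integral>\<^sup>+ t. u (z + circlepath 0 1 t *s w) * indicator {0..1} t \<partial>lborel \<partial>lborel)"
    by (intro nn_integral_mono circle)
  also have "\<dots> = (\<integral>\<^sup>+ t. \<integral>\<^sup>+ w. u (z + circlepath 0 1 t *s w) * indicator {0..1} t \<partial>lborel \<partial>lborel)"
    by (rule lborel_pair.Fubini'[symmetric]) measurable
  also have "\<dots> = Lp_integral p (ball z r) f"
    by (simp add: nn_integral_multc nn_integral_cmult nn_integral_lborel_rotate norm_circle)
      (simp add: u_def Lp_integral_def)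
  finally show ?thesis .
qed

section \<open>The spaces of p-integrable holomorphic functions\<close>

lemma Lp_integral_mono_set: "D \<subseteq> E \<Longrightarrow> Lp_integral p D f \<le> Lp_integral p E f"
  unfolding Lp_integral_def by (intro nn_integral_mono) (auto split: split_indicator)

lemma Lp_integral_cong: "(\<And>z. z \<in> D \<Longrightarrow> f z = g z) \<Longrightarrow> Lp_integral p D f = Lp_integral p D g"
  unfolding Lp_integral_def by (intro nn_integral_cong) (auto split: split_indicator)

lemma Lp_integral_cmult:
  assumes [measurable]: "set_borel_measurable borel D f"
  shows "Lp_integral p D (\<lambda>z. c * f z) = ennreal (norm c powr p) * Lp_integral p D f"
  unfolding Lp_integral_def
  by (subst nn_integral_cmult[symmetric])
     (auto simp: norm_mult powr_mult ennreal_mult' mult.assoc)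

lemma powr_add_le_weighted:
  fixes x y a b p :: real
  assumes "0 \<le> x" "0 \<le> y" "0 < a" "0 < b" "1 \<le> p"
  shows "(x + y) powr p
    \<le> (a + b) powr (p - 1) * (x powr p / a powr (p - 1) + y powr p / b powr (p - 1))"
proof (cases "x + y = 0")
  case False
  define m k where "m = (x + y) / (a + b)" and "k = p * m powr (p - 1)"
  have "0 < m"
    using assms False by (simp add: m_def add_nonneg_pos order_less_le)
  have tangent: "c * m powr p + k * (w - c * m) \<le> w powr p / c powr (p - 1)"
    if "0 < c" "0 \<le> w" for c w
  proof -
    have "c * m powr p + k * (w - c * m) = c * (m powr p + k * (w / c - m))"
      using that by (simp add: distrib_left right_diff_distrib)
    also have "\<dots> \<le> c * (w / c) powr p"
      unfolding k_def using that \<open>0 < m\<close> \<open>1 \<le> p\<close> by (intro mult_left_mono powr_ge_tangent) auto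
    also have "\<dots> = w powr p / c powr (p - 1)"
      using that powr_eq_mult_powr_minus_1[of c p] by (simp add: powr_divide)
    finally show ?thesis .
  qed
  have "k * ((x + y) - (a + b) * m) = 0"
    using assms by (simp add: m_def)
  then have "(a + b) * m powr p = a * m powr p + k * (x - a * m) + (b * m powr p + k * (y - b * m))"
    by (simp add: algebra_simps)
  also have "\<dots> \<le> x powr p / a powr (p - 1) + y powr p / b powr (p - 1)"
    using assms by (intro add_mono tangent)
  finally have "(a + b) powr (p - 1) * ((a + b) * m powr p)
      \<le> (a + b) powr (p - 1) * (x powr p / a powr (p - 1) + y powr p / b powr (p - 1))"
    by (intro mult_left_mono) simp_all
  moreover have "(x + y) powr p = (a + b) powr (p - 1) * ((a + b) * m powr p)"
    using assms powr_eq_mult_powr_minus_1[of "a + b" p] by (simp add: m_def powr_divide)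
  ultimately show ?thesis by simp
qed (use assms in simp)

lemma Lp_integral_add_le:
  assumes [measurable]: "set_borel_measurable borel D f" "set_borel_measurable borel D g"
    and "1 \<le> p" "0 < a" "0 < b"
    and bound_f: "Lp_integral p D f \<le> ennreal (a powr p)"
    and bound_g: "Lp_integral p D g \<le> ennreal (b powr p)"
  shows "Lp_integral p D (\<lambda>z. f z + g z) \<le> ennreal ((a + b) powr p)"
proof -
  define A B where "A = (a + b) powr (p - 1) / a powr (p - 1)"
    and "B = (a + b) powr (p - 1) / b powr (p - 1)"
  have weights_nonneg: "0 \<le> A" "0 \<le> B" by (simp_all add: A_def B_def)
  have pointwise: "norm (f z + g z) powr p \<le> A * norm (f z) powr p + B * norm (g z) powr p" for z
  proof -
    have "norm (f z + g z) powr p \<le> (norm (f z) + norm (g z)) powr p"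
      using \<open>1 \<le> p\<close> by (intro powr_mono2 norm_triangle_ineq) auto
    also have "\<dots> \<le> A * norm (f z) powr p + B * norm (g z) powr p"
      using powr_add_le_weighted[of "norm (f z)" "norm (g z)" a b p] assms
      by (simp add: A_def B_def algebra_simps)
    finally show ?thesis .
  qed
  have "Lp_integral p D (\<lambda>z. f z + g z) \<le>
      (\<integral>\<^sup>+ z. ennreal A * (ennreal (norm (f z) powr p) * indicator D z)
        + ennreal B * (ennreal (norm (g z) powr p) * indicator D z) \<partial>lborel)"
    unfolding Lp_integral_def
    using pointwise weights_nonneg by (intro nn_integral_mono)
      (auto simp: ennreal_mult[symmetric] ennreal_plus[symmetric] simp del: ennreal_plus
        split: split_indicator)
  also have "\<dots> = ennreal A * Lp_integral p D f + ennreal B * Lp_integral p D g"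
    unfolding Lp_integral_def by (simp add: nn_integral_add nn_integral_cmult)
  also have "\<dots> \<le> ennreal A * ennreal (a powr p) + ennreal B * ennreal (b powr p)"
    by (intro add_mono mult_left_mono bound_f bound_g) auto
  also have "\<dots> = ennreal (A * a powr p + B * b powr p)"
    using weights_nonneg by (simp add: ennreal_mult)
  also have "A * a powr p + B * b powr p = (a + b) powr (p - 1) * (a + b)"
    using assms powr_eq_mult_powr_minus_1[of a p] powr_eq_mult_powr_minus_1[of b p]
    by (simp add: A_def B_def distrib_left)
  also have "\<dots> = (a + b) powr p"
    using assms powr_eq_mult_powr_minus_1[of "a + b" p] by (simp add: mult.commute)
  finally show ?thesis .
qed

lemma Lp_integral_Fatou:
  assumes [measurable]: "\<And>n::nat. set_borel_measurable borel D (f n)"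
    and lim: "\<And>z. z \<in> D \<Longrightarrow> (\<lambda>n. f n z) \<longlonglongrightarrow> g z"
    and bound: "\<And>n. Lp_integral p D (f n) \<le> C" and "0 < p"
  shows "Lp_integral p D g \<le> C"
proof -
  have "(\<lambda>n. ennreal (norm (f n z) powr p) * indicator D z)
      \<longlonglongrightarrow> ennreal (norm (g z) powr p) * indicator D z" for z
    using lim \<open>0 < p\<close>
    by (cases "z \<in> D") (auto intro!: tendsto_ennrealI tendsto_powr2 tendsto_norm)
  then have "liminf (\<lambda>n. ennreal (norm (f n z) powr p) * indicator D z)
      = ennreal (norm (g z) powr p) * indicator D z" for z
    by (intro lim_imp_Liminf) simp_all
  then have "Lp_integral p D g
      = (\<integral>\<^sup>+ z. liminf (\<lambda>n. ennreal (norm (f n z) powr p) * indicator D z) \<partial>lborel)"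
    by (simp add: Lp_integral_def)
  also have "\<dots> \<le> liminf (\<lambda>n. Lp_integral p D (f n))"
    unfolding Lp_integral_def by (rule nn_integral_liminf) measurable
  also have "\<dots> \<le> liminf (\<lambda>n. C)"
    by (intro Liminf_mono always_eventually allI bound)
  finally show ?thesis by (simp add: Liminf_const)
qed

lemma Lp_norm_nonneg [simp]: "0 \<le> Lp_norm p D f"
  by (simp add: Lp_norm_def)

lemma Lp_norm_zero [simp]: "Lp_norm p D (\<lambda>z. 0) = 0"
  by (simp add: Lp_norm_def Lp_integral_def)

lemma Lp_norm_minus_commute: "Lp_norm p D (\<lambda>z. f z - g z) = Lp_norm p D (\<lambda>z. g z - f z)"
  by (simp add: Lp_norm_def Lp_integral_def norm_minus_commute)

lemma Lp_norm_leI: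
  assumes "Lp_integral p D f \<le> ennreal (a powr p)" "0 < p" "0 \<le> a"
  shows "Lp_norm p D f \<le> a"
proof -
  have "enn2real (Lp_integral p D f) \<le> a powr p"
    using assms by (simp add: enn2real_leI)
  then have "Lp_norm p D f \<le> (a powr p) powr (1 / p)"
    unfolding Lp_norm_def using assms by (intro powr_mono2) auto
  then show ?thesis using assms by (simp add: powr_powr)
qed

lemma Lp_integral_eq_Lp_norm_powr:
  "Lp_integral p D f < \<infinity> \<Longrightarrow> 0 < p \<Longrightarrow> Lp_integral p D f = ennreal (Lp_norm p D f powr p)"
  by (simp add: Lp_norm_def powr_powr)

lemma Lp_integral_le_if_Lp_norm_le:
  assumes "Lp_integral p D f < \<infinity>" "Lp_norm p D f \<le> a" "0 < p"
  shows "Lp_integral p D f \<le> ennreal (a powr p)"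
  using assms by (simp add: Lp_integral_eq_Lp_norm_powr ennreal_leI powr_mono2)

lemma Lp_norm_cmult:
  assumes "set_borel_measurable borel D f" "0 < p"
  shows "Lp_norm p D (\<lambda>z. c * f z) = norm c * Lp_norm p D f"
  using assms by (simp add: Lp_norm_def Lp_integral_cmult enn2real_mult powr_mult powr_powr)

lemma OL_imp_set_borel_measurable: "open D \<Longrightarrow> OL p D f \<Longrightarrow> set_borel_measurable borel D f"
  by (simp add: OL_def holo_on_imp_set_borel_measurable)

lemma OL_subset: "OL p E f \<Longrightarrow> D \<subseteq> E \<Longrightarrow> OL p D f"
  unfolding OL_def using holo_on_subset Lp_integral_mono_set le_less_trans by blast

lemma OL_cong: "open D \<Longrightarrow> (\<And>z. z \<in> D \<Longrightarrow> f z = g z) \<Longrightarrow> OL p D f \<longleftrightarrow> OL p D g"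
  unfolding OL_def using holo_on_cong[of D f g] Lp_integral_cong[of D f g] by simp

lemma OL_cmult: "open D \<Longrightarrow> OL p D f \<Longrightarrow> OL p D (\<lambda>z. c * f z)"
  by (simp add: OL_def holo_on_cmult Lp_integral_cmult holo_on_imp_set_borel_measurable
      ennreal_mult_less_top)

context
  fixes D :: "(complex^'n) set" and p :: real
  assumes "open D" "1 \<le> p"
begin

lemma OL_add_Lp_integral_le:
  assumes OL_f: "OL p D f" and OL_g: "OL p D g" and "0 < e"
  shows "Lp_integral p D (\<lambda>z. f z + g z) \<le> ennreal ((Lp_norm p D f + Lp_norm p D g + e) powr p)"
proof -
  have "Lp_integral p D h \<le> ennreal ((Lp_norm p D h + e / 2) powr p)" if "OL p D h" for h
    using that \<open>0 < e\<close> \<open>1 \<le> p\<close> by (intro Lp_integral_le_if_Lp_norm_le) (auto simp: OL_def)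
  then have "Lp_integral p D (\<lambda>z. f z + g z)
      \<le> ennreal ((Lp_norm p D f + e / 2 + (Lp_norm p D g + e / 2)) powr p)"
    using \<open>open D\<close> \<open>1 \<le> p\<close> \<open>0 < e\<close> OL_f OL_g
    by (intro Lp_integral_add_le OL_imp_set_borel_measurable) (auto intro: add_nonneg_pos)
  then show ?thesis by (simp add: algebra_simps)
qed

lemma OL_add: "OL p D f \<Longrightarrow> OL p D g \<Longrightarrow> OL p D (\<lambda>z. f z + g z)"
  using OL_add_Lp_integral_le[of f g 1] by (auto simp: OL_def holo_on_add intro: le_less_trans)

lemma OL_diff: "OL p D f \<Longrightarrow> OL p D g \<Longrightarrow> OL p D (\<lambda>z. f z - g z)"
  using OL_add[of f "\<lambda>z. -1 * g z"] OL_cmult[OF \<open>open D\<close>, of p g "-1"] by simp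

lemma Lp_norm_triangle:
  assumes "OL p D f" "OL p D g"
  shows "Lp_norm p D (\<lambda>z. f z + g z) \<le> Lp_norm p D f + Lp_norm p D g"
proof (rule field_le_epsilon)
  fix e :: real assume "0 < e"
  then show "Lp_norm p D (\<lambda>z. f z + g z) \<le> Lp_norm p D f + Lp_norm p D g + e"
    using OL_add_Lp_integral_le[OF assms] \<open>1 \<le> p\<close> by (intro Lp_norm_leI) auto
qed

end

lemma OL_mono_exponent:
  assumes "open D" "emeasure lborel D < \<infinity>" "0 \<le> p" "p \<le> r" and OL_f: "OL r D f"
  shows "OL p D f"
proof -
  have [measurable]: "set_borel_measurable borel D f" "D \<in> sets borel"
    using assms by (auto intro: OL_imp_set_borel_measurable)
  have "x powr p \<le> 1 + x powr r" if "0 \<le> x" for x :: real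
  proof (cases "x \<le> 1")
    case True
    then have "x powr p \<le> 1" using powr_mono2[of p x 1] that \<open>0 \<le> p\<close> by simp
    then show ?thesis by (simp add: add_increasing2)
  next
    case False
    then have "x powr p \<le> x powr r" using \<open>p \<le> r\<close> by (intro powr_mono) auto
    then show ?thesis by simp
  qed
  then have "ennreal (norm (f z) powr p) \<le> 1 + ennreal (norm (f z) powr r)" for z
    using ennreal_leI[of "norm (f z) powr p" "1 + norm (f z) powr r"] by simp
  then have "Lp_integral p D f
      \<le> (\<integral>\<^sup>+ z. indicator D z + ennreal (norm (f z) powr r) * indicator D z \<partial>lborel)"
    unfolding Lp_integral_def by (intro nn_integral_mono) (auto split: split_indicator)
  also have "\<dots> = emeasure lborel D + Lp_integral r D f"
    unfolding Lp_integral_def by (subst nn_integral_add) auto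
  also have "\<dots> < \<infinity>"
    using assms by (simp add: OL_def)
  finally show ?thesis using OL_f by (simp add: OL_def)
qed

lemma norm_le_Lp_norm:
  fixes f :: "complex^'n \<Rightarrow> complex"
  assumes "OL p D f" "ball z r \<subseteq> D" "1 \<le> p"
  shows "norm (f z) * measure lborel (ball 0 r :: (complex^'n) set) powr (1 / p) \<le> Lp_norm p D f"
proof -
  let ?B = "ball 0 r :: (complex^'n) set"
  have "emeasure lborel ?B = ennreal (measure lborel ?B)"
    using less_imp_neq[OF emeasure_lborel_ball_finite] by (intro emeasure_eq_ennreal_measure) simp
  then have "ennreal (norm (f z) powr p * measure lborel ?B)
      = ennreal (norm (f z) powr p) * emeasure lborel ?B"
    by (simp add: ennreal_mult)
  also have "\<dots> \<le> Lp_integral p (ball z r) f"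
    using assms
    by (intro powr_norm_le_ball_mean holo_on_subset[OF _ assms(2)]) (simp_all add: OL_def)
  also have "\<dots> \<le> Lp_integral p D f"
    using assms by (intro Lp_integral_mono_set)
  also have "\<dots> = ennreal (Lp_norm p D f powr p)"
    using assms by (intro Lp_integral_eq_Lp_norm_powr) (simp_all add: OL_def)
  finally have "norm (f z) powr p * measure lborel ?B \<le> Lp_norm p D f powr p"
    by simp
  then have "(norm (f z) powr p * measure lborel ?B) powr (1 / p)
      \<le> (Lp_norm p D f powr p) powr (1 / p)"
    using assms by (intro powr_mono2) auto
  then show ?thesis
    using assms by (simp add: powr_mult powr_powr)
qed

lemma compact_norm_le_Lp_norm:
  fixes K :: "(complex^'n) set"
  assumes "open D" "compact K" "K \<subseteq> D" "1 \<le> p"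
  obtains C where "0 < C" "\<And>f z. OL p D f \<Longrightarrow> z \<in> K \<Longrightarrow> norm (f z) \<le> C * Lp_norm p D f"
proof -
  obtain r where balls_in_D: "0 < r" "(\<Union>z\<in>K. ball z r) \<subseteq> D"
    using compact_subset_open_imp_ball_epsilon_subset assms by metis
  define V where "V = measure lborel (ball 0 r :: (complex^'n) set) powr (1 / p)"
  have "0 < measure lborel (ball 0 r :: (complex^'n) set)"
    using \<open>0 < r\<close> by (rule content_ball_pos)
  then have "0 < V" by (simp add: V_def)
  moreover have "norm (f z) \<le> 1 / V * Lp_norm p D f" if "OL p D f" "z \<in> K" for f z
    using norm_le_Lp_norm[of p D f z r] that balls_in_D(2) \<open>1 \<le> p\<close> \<open>0 < V\<close>
    by (fastforce simp: V_def[symmetric] pos_le_divide_eq)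
  ultimately show ?thesis using that[of "1 / V"] by simp
qed

lemma OL_eq_0_if_Lp_norm_eq_0:
  assumes "open D" "1 \<le> p" "OL p D f" "Lp_norm p D f = 0" "z \<in> D"
  shows "f z = 0"
proof -
  obtain C where "\<And>f w. OL p D f \<Longrightarrow> w \<in> {z} \<Longrightarrow> norm (f w) \<le> C * Lp_norm p D f"
    using compact_norm_le_Lp_norm[of D "{z}" p] assms(1,2,5)
    by (metis compact_sing empty_subsetI insert_subset)
  from this[OF \<open>OL p D f\<close>, of z] show ?thesis using assms(4) by simp
qed

definition Lp_Cauchy :: "real \<Rightarrow> (complex^'n) set \<Rightarrow> (nat \<Rightarrow> complex^'n \<Rightarrow> complex) \<Rightarrow> bool" where
  "Lp_Cauchy p D f \<longleftrightarrow> (\<forall>e>0. \<exists>N. \<forall>m\<ge>N. \<forall>n\<ge>N. Lp_norm p D (\<lambda>z. f m z - f n z) < e)"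

lemma Lp_Cauchy_imp_uniform_limit:
  assumes "open D" "1 \<le> p" and OL_f: "\<And>n. OL p D (f n)" and "Lp_Cauchy p D f"
    and "compact K" "K \<subseteq> D"
  shows "uniform_limit K f (\<lambda>z. lim (\<lambda>n. f n z)) sequentially"
proof -
  obtain C where point_bound: "0 < C" "\<And>h z. OL p D h \<Longrightarrow> z \<in> K \<Longrightarrow> norm (h z) \<le> C * Lp_norm p D h"
    using compact_norm_le_Lp_norm assms by metis
  have "uniformly_Cauchy_on K f"
    unfolding uniformly_Cauchy_on_def
  proof (intro allI impI)
    fix e :: real assume "0 < e"
    then obtain N
      where close_after_N: "\<And>m n. m \<ge> N \<Longrightarrow> n \<ge> N \<Longrightarrow> Lp_norm p D (\<lambda>z. f m z - f n z) < e / C"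
      using \<open>Lp_Cauchy p D f\<close> point_bound(1) unfolding Lp_Cauchy_def by (meson divide_pos_pos)
    have "dist (f m z) (f n z) < e" if "z \<in> K" "m \<ge> N" "n \<ge> N" for m n z
    proof -
      have "dist (f m z) (f n z) \<le> C * Lp_norm p D (\<lambda>z. f m z - f n z)"
        unfolding dist_norm using assms OL_f that by (intro point_bound(2) OL_diff)
      also have "\<dots> < e"
        using close_after_N[OF that(2,3)] point_bound(1)
        by (simp add: pos_less_divide_eq mult.commute)
      finally show ?thesis .
    qed
    then show "\<exists>M. \<forall>z\<in>K. \<forall>m\<ge>M. \<forall>n\<ge>M. dist (f m z) (f n z) < e" by blast
  qed
  then show ?thesis
    using Cauchy_uniformly_convergent uniformly_convergent_uniform_limit_iff by blast
qed

lemma Lp_Cauchy_imp_holo_on_lim: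
  assumes "open D" "1 \<le> p" "\<And>n. OL p D (f n)" "Lp_Cauchy p D f"
  shows "holo_on (\<lambda>z. lim (\<lambda>n. f n z)) D"
proof (rule holo_on_uniform_limit)
  fix z assume "z \<in> D"
  then obtain r where "0 < r" "cball z r \<subseteq> D"
    using \<open>open D\<close> open_contains_cball by blast
  then show "\<exists>r>0. cball z r \<subseteq> D \<and> uniform_limit (cball z r) f (\<lambda>z. lim (\<lambda>n. f n z)) sequentially"
    using Lp_Cauchy_imp_uniform_limit[OF assms compact_cball] by blast
qed (use assms in \<open>simp add: OL_def\<close>)

lemma Lp_integral_diff_limit_le:
  assumes "open D" "1 \<le> p" and OL_f: "\<And>n. OL p D (f n)"
    and close_after_N: "\<And>m. m \<ge> N \<Longrightarrow> Lp_norm p D (\<lambda>z. f n z - f m z) < e"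
    and lim: "\<And>z. z \<in> D \<Longrightarrow> (\<lambda>n. f n z) \<longlonglongrightarrow> g z"
  shows "Lp_integral p D (\<lambda>z. f n z - g z) \<le> ennreal (e powr p)"
proof (rule Lp_integral_Fatou[where f = "\<lambda>m z. f n z - f (m + N) z"])
  have OL_diff_f: "OL p D (\<lambda>z. f n z - f (m + N) z)" for m
    using assms by (intro OL_diff OL_f)
  then show "set_borel_measurable borel D (\<lambda>z. f n z - f (m + N) z)" for m
    using OL_imp_set_borel_measurable[OF \<open>open D\<close>] by blast
  show "Lp_integral p D (\<lambda>z. f n z - f (m + N) z) \<le> ennreal (e powr p)" for m
    using OL_diff_f[of m] close_after_N[of "m + N"] \<open>1 \<le> p\<close>
    by (intro Lp_integral_le_if_Lp_norm_le) (auto simp: OL_def)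
  show "(\<lambda>m. f n z - f (m + N) z) \<longlonglongrightarrow> f n z - g z" if "z \<in> D" for z
    using LIMSEQ_ignore_initial_segment[OF lim[OF that], of N] by (intro tendsto_intros)
qed (use \<open>1 \<le> p\<close> in simp)

lemma Lp_Cauchy_imp_OL_limit:
  assumes "open D" "1 \<le> p" and OL_f: "\<And>n. OL p D (f n)" and "Lp_Cauchy p D f"
    and "holo_on g D" and lim: "\<And>z. z \<in> D \<Longrightarrow> (\<lambda>n. f n z) \<longlonglongrightarrow> g z"
  shows "OL p D g" and "(\<lambda>n. Lp_norm p D (\<lambda>z. f n z - g z)) \<longlonglongrightarrow> 0"
proof -
  have close: "\<exists>N. \<forall>n\<ge>N. Lp_integral p D (\<lambda>z. f n z - g z) \<le> ennreal (e powr p)" if "0 < e" for e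
  proof -
    obtain N where "\<And>m n. m \<ge> N \<Longrightarrow> n \<ge> N \<Longrightarrow> Lp_norm p D (\<lambda>z. f m z - f n z) < e"
      using \<open>Lp_Cauchy p D f\<close> \<open>0 < e\<close> unfolding Lp_Cauchy_def by blast
    then show ?thesis
      using Lp_integral_diff_limit_le[OF \<open>open D\<close> \<open>1 \<le> p\<close> OL_f _ lim] by blast
  qed
  obtain N where "Lp_integral p D (\<lambda>z. f N z - g z) \<le> ennreal (1 powr p)"
    using close[of 1] by auto
  then have "OL p D (\<lambda>z. f N z - g z)"
    using OL_f \<open>holo_on g D\<close> by (auto simp: OL_def holo_on_diff intro: le_less_trans)
  with OL_f have "OL p D (\<lambda>z. f N z - (f N z - g z))"
    by (rule OL_diff[OF \<open>open D\<close> \<open>1 \<le> p\<close>])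
  then show "OL p D g" by simp
  show "(\<lambda>n. Lp_norm p D (\<lambda>z. f n z - g z)) \<longlonglongrightarrow> 0"
  proof (rule metric_LIMSEQ_I)
    fix e :: real assume "0 < e"
    then obtain N where "\<forall>n\<ge>N. Lp_integral p D (\<lambda>z. f n z - g z) \<le> ennreal ((e / 2) powr p)"
      using close[of "e / 2"] by auto
    then have "\<forall>n\<ge>N. Lp_norm p D (\<lambda>z. f n z - g z) \<le> e / 2"
      using \<open>0 < e\<close> \<open>1 \<le> p\<close> by (intro allI impI Lp_norm_leI) auto
    then show "\<exists>N. \<forall>n\<ge>N. dist (Lp_norm p D (\<lambda>z. f n z - g z)) 0 < e"
      using \<open>0 < e\<close> by (intro exI[of _ N]) auto
  qed
qed

definition Lq_size :: "ereal \<Rightarrow> (complex^'n) set \<Rightarrow> (complex^'n \<Rightarrow> complex) \<Rightarrow> ennreal" where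
  "Lq_size q D f =
    (if q = \<infinity> then SUP z\<in>D. ennreal (norm (f z)) else Lp_integral (real_of_ereal q) D f)"

lemma bounded_image_iff_SUP_ennreal_finite:
  "bounded (f ` D) \<longleftrightarrow> (SUP z\<in>D. ennreal (norm (f z))) < \<infinity>"
proof
  assume "bounded (f ` D)"
  then obtain b where "\<And>z. z \<in> D \<Longrightarrow> norm (f z) \<le> b" by (auto simp: bounded_iff)
  then have "(SUP z\<in>D. ennreal (norm (f z))) \<le> ennreal b"
    by (intro SUP_least ennreal_leI)
  then show "(SUP z\<in>D. ennreal (norm (f z))) < \<infinity>"
    by (simp add: le_less_trans)
next
  assume "(SUP z\<in>D. ennreal (norm (f z))) < \<infinity>"
  then obtain b where SUP_eq: "(SUP z\<in>D. ennreal (norm (f z))) = ennreal b" "0 \<le> b"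
    by (auto simp: less_top_ennreal)
  have "norm (f z) \<le> b" if "z \<in> D" for z
    using SUP_upper[OF that, of "\<lambda>z. ennreal (norm (f z))"] SUP_eq by simp
  then show "bounded (f ` D)" by (auto simp: bounded_iff)
qed

lemma OLq_iff_Lq_size: "OLq q D f \<longleftrightarrow> holo_on f D \<and> Lq_size q D f < \<infinity>"
  by (simp add: OLq_def OL_def OL_inf_def Lq_size_def bounded_image_iff_SUP_ennreal_finite)

lemma OLq_subset: "OLq q E f \<Longrightarrow> D \<subseteq> E \<Longrightarrow> OLq q D f"
  by (auto simp: OLq_def OL_inf_def OL_subset intro: holo_on_subset bounded_subset[OF _ image_mono]
      split: if_splits)

lemma OLq_cong: "open D \<Longrightarrow> (\<And>z. z \<in> D \<Longrightarrow> f z = g z) \<Longrightarrow> OLq q D f \<longleftrightarrow> OLq q D g"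
  using OL_cong[of D f g] holo_on_cong[of D f g]
  by (simp add: OLq_def OL_inf_def cong: image_cong)

lemma real_of_ereal_ge_1: "1 \<le> q \<Longrightarrow> q \<noteq> \<infinity> \<Longrightarrow> 1 \<le> real_of_ereal q"
  by (cases q) auto

lemma OLq_cmult:
  assumes "open D" "OLq q D f"
  shows "OLq q D (\<lambda>z. c * f z)"
proof -
  have "bounded ((\<lambda>z. c * f z) ` D)" if "bounded (f ` D)"
    using bounded_linear_image[OF that bounded_linear_mult_right[of c]] by (simp add: image_image)
  with assms show ?thesis
    by (simp add: OLq_def OL_inf_def OL_cmult holo_on_cmult split: if_splits)
qed

lemma OLq_add: "open D \<Longrightarrow> 1 \<le> q \<Longrightarrow> OLq q D f \<Longrightarrow> OLq q D g \<Longrightarrow> OLq q D (\<lambda>z. f z + g z)"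
  by (auto simp: OLq_def OL_inf_def OL_add holo_on_add real_of_ereal_ge_1 bounded_plus_comp
      split: if_splits)

lemma Lq_size_limit_le:
  assumes "\<And>n::nat. set_borel_measurable borel D (f n)"
    and lim: "\<And>z. z \<in> D \<Longrightarrow> (\<lambda>n. f n z) \<longlonglongrightarrow> g z"
    and bound: "\<And>n. Lq_size q D (f n) \<le> C" and "1 \<le> q"
  shows "Lq_size q D g \<le> C"
proof (cases "q = \<infinity>")
  case True
  have "ennreal (norm (g z)) \<le> C" if "z \<in> D" for z
  proof (rule LIMSEQ_le_const2)
    show "(\<lambda>n. ennreal (norm (f n z))) \<longlonglongrightarrow> ennreal (norm (g z))"
      using that by (intro tendsto_ennrealI tendsto_norm lim)
    show "\<exists>N. \<forall>n\<ge>N. ennreal (norm (f n z)) \<le> C"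
      using bound that True by (auto simp: Lq_size_def SUP_le_iff)
  qed
  then show ?thesis using True by (auto simp: Lq_size_def SUP_le_iff)
next
  case False
  then have "0 < real_of_ereal q" using real_of_ereal_ge_1[of q] \<open>1 \<le> q\<close> by simp
  with False assms show ?thesis
    unfolding Lq_size_def by (auto intro: Lp_integral_Fatou)
qed

section \<open>The complete metric\<close>

definition F_norm_term :: "nat \<Rightarrow> real \<Rightarrow> real" where
  "F_norm_term j t = (1/2) ^ Suc j * (t / (1 + t))"

definition F_norm :: "(nat \<Rightarrow> real) \<Rightarrow> real" where
  "F_norm x = (\<Sum>j. F_norm_term j (x j))"

lemma F_norm_term_zero [simp]: "F_norm_term j 0 = 0"
  by (simp add: F_norm_term_def)

lemma F_norm_term_less_iff:
  assumes "0 \<le> s" "0 \<le> t"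
  shows "F_norm_term j s < F_norm_term j t \<longleftrightarrow> s < t"
proof -
  have "F_norm_term j s < F_norm_term j t \<longleftrightarrow> s / (1 + s) < t / (1 + t)"
    unfolding F_norm_term_def by (rule mult_less_cancel_left_pos) simp
  also have "\<dots> \<longleftrightarrow> s < t"
    using assms by (simp add: divide_simps algebra_simps)
  finally show ?thesis .
qed

lemma F_norm_term_nonneg: "0 \<le> t \<Longrightarrow> 0 \<le> F_norm_term j t"
  by (simp add: F_norm_term_def)

lemma F_norm_term_le: "0 \<le> t \<Longrightarrow> F_norm_term j t \<le> (1/2) ^ Suc j"
  unfolding F_norm_term_def by (intro mult_left_le) (auto simp: divide_simps)

lemma F_norm_term_subadditive:
  assumes nonneg: "0 \<le> x" "0 \<le> y" "0 \<le> z" and "z \<le> x + y"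
  shows "F_norm_term j z \<le> F_norm_term j x + F_norm_term j y"
proof -
  have "z / (1 + z) \<le> (x + y) / (1 + (x + y))"
    using assms by (simp add: divide_simps algebra_simps)
  also have "\<dots> = x / (1 + (x + y)) + y / (1 + (x + y))"
    by (simp add: add_divide_distrib)
  also have "\<dots> \<le> x / (1 + x) + y / (1 + y)"
    using nonneg by (intro add_mono divide_left_mono) auto
  finally show ?thesis
    unfolding F_norm_term_def distrib_left[symmetric] by (intro mult_left_mono) simp_all
qed

lemma summable_half_power_Suc: "summable (\<lambda>j. (1/2 :: real) ^ Suc j)"
  by (simp add: summable_geometric)

lemma summable_F_norm_term:
  assumes "\<And>j. 0 \<le> x j"
  shows "summable (\<lambda>j. F_norm_term j (x j))"
  by (rule summable_comparison_test'[OF summable_half_power_Suc])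
    (simp add: F_norm_term_nonneg F_norm_term_le assms del: power_Suc)

lemma F_norm_nonneg: "(\<And>j. 0 \<le> x j) \<Longrightarrow> 0 \<le> F_norm x"
  unfolding F_norm_def by (intro suminf_nonneg summable_F_norm_term F_norm_term_nonneg)

lemma F_norm_term_le_F_norm:
  assumes "\<And>j. 0 \<le> x j"
  shows "F_norm_term j (x j) \<le> F_norm x"
  unfolding F_norm_def
  using sum_le_suminf[OF summable_F_norm_term[of x], of "{j}"] assms
  by (simp add: F_norm_term_nonneg)

lemma F_norm_less_imp_less:
  assumes "\<And>j. 0 \<le> x j" and "0 \<le> e" "F_norm x < F_norm_term j e"
  shows "x j < e"
proof -
  have "F_norm_term j (x j) < F_norm_term j e"
    using F_norm_term_le_F_norm[of x j] assms by simp
  then show ?thesis using assms by (simp add: F_norm_term_less_iff)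
qed

lemma F_norm_eq_0_iff:
  assumes nonneg: "\<And>j. 0 \<le> x j"
  shows "F_norm x = 0 \<longleftrightarrow> (\<forall>j. x j = 0)"
proof
  assume "F_norm x = 0"
  then have "\<not> 0 < x j" for j
    using F_norm_term_le_F_norm[of x j] F_norm_term_less_iff[of 0 "x j" j] nonneg by simp
  then show "\<forall>j. x j = 0"
    using nonneg by (metis less_le)
qed (simp add: F_norm_def)

lemma F_norm_subadditive:
  assumes "\<And>j. 0 \<le> x j" "\<And>j. 0 \<le> y j" "\<And>j. 0 \<le> z j" "\<And>j. z j \<le> x j + y j"
  shows "F_norm z \<le> F_norm x + F_norm y"
  unfolding F_norm_def suminf_add[OF summable_F_norm_term summable_F_norm_term, OF assms(1,2)]
  using assms by (intro suminf_le summable_add summable_F_norm_term F_norm_term_subadditive)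

lemma tendsto_F_norm_0:
  assumes "\<And>n j. 0 \<le> x n j" "\<And>j. ((\<lambda>n. x n j) \<longlongrightarrow> 0) F" "F \<noteq> bot"
  shows "((\<lambda>n. F_norm (x n)) \<longlongrightarrow> 0) F"
proof -
  have "((\<lambda>n. (1/2) ^ Suc j * (x n j / (1 + x n j))) \<longlongrightarrow> (1/2) ^ Suc j * (0 / (1 + 0))) F" for j
    by (intro tendsto_intros assms) simp
  then have "((\<lambda>n. F_norm_term j (x n j)) \<longlongrightarrow> 0) F" for j
    by (simp add: F_norm_term_def)
  then have "((\<lambda>n. \<Sum>j. F_norm_term j (x n j)) \<longlongrightarrow> (\<Sum>j. 0)) F"
    using tannerys_theorem[of "\<lambda>j n. F_norm_term j (x n j)" "\<lambda>_. 0" F "\<lambda>j. (1/2) ^ Suc j"]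
      summable_half_power_Suc assms(1,3)
    by (simp add: case_prod_unfold F_norm_term_nonneg F_norm_term_le del: power_Suc)
  then show ?thesis by (simp add: F_norm_def)
qed

lemma OL_dist_eq_F_norm: "OL_dist pj D f g = F_norm (\<lambda>j. Lp_norm (pj j) D (\<lambda>z. f z - g z))"
  by (simp add: OL_dist_def F_norm_def F_norm_term_def)

lemma OL_space_outside: "f \<in> OL_space q D \<Longrightarrow> z \<notin> D \<Longrightarrow> f z = 0"
  by (simp add: OL_space_def)

lemma OL_space_add: "open D \<Longrightarrow> f \<in> OL_space q D \<Longrightarrow> g \<in> OL_space q D \<Longrightarrow> (\<lambda>z. f z + g z) \<in> OL_space q D"
  by (simp add: OL_space_def OL_below_def OL_add)

lemma OL_space_cmult: "open D \<Longrightarrow> f \<in> OL_space q D \<Longrightarrow> (\<lambda>z. c * f z) \<in> OL_space q D"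
  by (simp add: OL_space_def OL_below_def OL_cmult)

locale OL_metric_space =
  fixes \<Omega> :: "(complex^'n) set" and q :: ereal and pj :: "nat \<Rightarrow> real"
  assumes bounded_\<Omega>: "bounded \<Omega>" and open_\<Omega>: "open \<Omega>"
    and pj_ge_1: "\<And>j. 1 \<le> pj j" and pj_less_q: "\<And>j. ereal (pj j) < q"
    and pj_tendsto_q: "(\<lambda>j. ereal (pj j)) \<longlonglongrightarrow> q"
begin

abbreviation X :: "(complex^'n \<Rightarrow> complex) set" where "X \<equiv> OL_space q \<Omega>"

abbreviation d :: "(complex^'n \<Rightarrow> complex) \<Rightarrow> (complex^'n \<Rightarrow> complex) \<Rightarrow> real"
  where "d \<equiv> OL_dist pj \<Omega>"

lemma q_gt_1: "1 < q"
  using pj_ge_1[of 0] pj_less_q[of 0] by (metis ereal_less_eq(3) le_less_trans one_ereal_def)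

lemma mem_OL_space_iff: "f \<in> X \<longleftrightarrow> (\<forall>j. OL (pj j) \<Omega> f) \<and> (\<forall>z. z \<notin> \<Omega> \<longrightarrow> f z = 0)"
proof -
  have "OL p \<Omega> f" if OL_f: "\<forall>j. OL (pj j) \<Omega> f" and p_range: "1 \<le> p" "ereal p < q" for p
  proof -
    obtain j where "p < pj j"
      using order_tendstoD(1)[OF pj_tendsto_q p_range(2)] by (auto simp: eventually_sequentially)
    then show ?thesis
      using OL_f p_range(1) open_\<Omega> emeasure_bounded_finite[OF bounded_\<Omega>]
      by (intro OL_mono_exponent[where p = p and r = "pj j"]) auto
  qed
  then show ?thesis
    using pj_ge_1 pj_less_q by (auto simp: OL_space_def OL_below_def)
qed

lemma OL_space_imp_OL: "f \<in> X \<Longrightarrow> OL (pj j) \<Omega> f"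
  by (simp add: mem_OL_space_iff)

lemma OL_space_imp_holo_on: "f \<in> X \<Longrightarrow> holo_on f \<Omega>"
  using OL_space_imp_OL[of f 0] by (simp add: OL_def)

sublocale OL: Metric_space X d
proof
  show "0 \<le> d f g" for f g
    by (simp add: OL_dist_eq_F_norm F_norm_nonneg)
  show "d f g = d g f" for f g
    by (simp add: OL_dist_eq_F_norm Lp_norm_minus_commute[of _ _ f g])
  show "d f g = 0 \<longleftrightarrow> f = g" if in_X: "f \<in> X" "g \<in> X" for f g
  proof
    assume "d f g = 0"
    then have "Lp_norm (pj 0) \<Omega> (\<lambda>z. f z - g z) = 0"
      by (simp add: OL_dist_eq_F_norm F_norm_eq_0_iff)
    moreover have "OL (pj 0) \<Omega> (\<lambda>z. f z - g z)"
      using in_X by (intro OL_diff open_\<Omega> pj_ge_1 OL_space_imp_OL)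
    ultimately have "f z - g z = 0" if "z \<in> \<Omega>" for z
      using OL_eq_0_if_Lp_norm_eq_0[OF open_\<Omega> pj_ge_1] that by blast
    then show "f = g"
      using OL_space_outside in_X by (metis eq_iff_diff_eq_0 ext)
  qed (simp add: OL_dist_eq_F_norm F_norm_eq_0_iff)
  show "d f h \<le> d f g + d g h" if "f \<in> X" "g \<in> X" "h \<in> X" for f g h
    unfolding OL_dist_eq_F_norm
  proof (rule F_norm_subadditive)
    show "Lp_norm (pj j) \<Omega> (\<lambda>z. f z - h z)
        \<le> Lp_norm (pj j) \<Omega> (\<lambda>z. f z - g z) + Lp_norm (pj j) \<Omega> (\<lambda>z. g z - h z)" for j
      using Lp_norm_triangle[OF open_\<Omega> pj_ge_1, of j "\<lambda>z. f z - g z" "\<lambda>z. g z - h z"] that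
      by (simp add: OL_diff open_\<Omega> pj_ge_1 OL_space_imp_OL)
  qed simp_all
qed

lemma MCauchy_imp_Lp_Cauchy:
  assumes "OL.MCauchy f"
  shows "Lp_Cauchy (pj j) \<Omega> f"
  unfolding Lp_Cauchy_def
proof (intro allI impI)
  fix e :: real assume "0 < e"
  then have "0 < F_norm_term j e"
    using F_norm_term_less_iff[of 0 e j] by simp
  then obtain N where "\<And>m n. N \<le> m \<Longrightarrow> N \<le> n \<Longrightarrow> d (f m) (f n) < F_norm_term j e"
    using assms unfolding OL.MCauchy_def by meson
  then have "Lp_norm (pj j) \<Omega> (\<lambda>z. f m z - f n z) < e" if "m \<ge> N" "n \<ge> N" for m n
    using F_norm_less_imp_less[of "\<lambda>j. Lp_norm (pj j) \<Omega> (\<lambda>z. f m z - f n z)" e j] \<open>0 < e\<close> that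
    by (simp add: OL_dist_eq_F_norm)
  then show "\<exists>N. \<forall>m\<ge>N. \<forall>n\<ge>N. Lp_norm (pj j) \<Omega> (\<lambda>z. f m z - f n z) < e" by blast
qed

lemma MCauchy_imp_pointwise_tendsto_lim:
  assumes "OL.MCauchy f" "z \<in> \<Omega>"
  shows "(\<lambda>n. f n z) \<longlonglongrightarrow> lim (\<lambda>n. f n z)"
proof -
  have "OL (pj 0) \<Omega> (f n)" for n
    using assms by (intro OL_space_imp_OL) (auto simp: OL.MCauchy_def)
  then have "uniform_limit {z} f (\<lambda>z. lim (\<lambda>n. f n z)) sequentially"
    using assms
    by (intro Lp_Cauchy_imp_uniform_limit[of \<Omega> "pj 0"] open_\<Omega> pj_ge_1 MCauchy_imp_Lp_Cauchy) auto
  then show ?thesis by simp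
qed

lemma limitin_OLI:
  assumes "g \<in> X" "\<And>n. f n \<in> X" "\<And>j. (\<lambda>n. Lp_norm (pj j) \<Omega> (\<lambda>z. f n z - g z)) \<longlonglongrightarrow> 0"
  shows "limitin OL.mtopology f g sequentially"
  using assms
  by (simp add: OL.limitin_metric_dist_null OL_dist_eq_F_norm tendsto_F_norm_0)

lemma MCauchy_imp_limitin_lim:
  assumes "OL.MCauchy f"
  shows "limitin OL.mtopology f (\<lambda>z. lim (\<lambda>n. f n z)) sequentially"
proof -
  let ?g = "\<lambda>z. lim (\<lambda>n. f n z)"
  have f_in_X: "f n \<in> X" for n using assms by (auto simp: OL.MCauchy_def)
  note OL_f = OL_space_imp_OL[OF f_in_X] and Cauchy = MCauchy_imp_Lp_Cauchy[OF assms]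
  have g_holo: "holo_on ?g \<Omega>"
    using open_\<Omega> pj_ge_1 OL_f Cauchy by (rule Lp_Cauchy_imp_holo_on_lim)
  note limit = Lp_Cauchy_imp_OL_limit[OF open_\<Omega> pj_ge_1 OL_f Cauchy g_holo
      MCauchy_imp_pointwise_tendsto_lim[OF assms]]
  have "?g \<in> X"
    using limit(1) OL_space_outside[OF f_in_X] by (simp add: mem_OL_space_iff)
  then show ?thesis using f_in_X limit(2) by (rule limitin_OLI)
qed

lemma mcomplete_OL: "OL.mcomplete"
  using MCauchy_imp_limitin_lim unfolding OL.mcomplete_def by blast

lemma limitin_OL_imp_pointwise:
  assumes f_in_X: "\<And>n. f n \<in> X" and lim: "limitin OL.mtopology f g sequentially" and "z \<in> \<Omega>"
  shows "(\<lambda>n. f n z) \<longlonglongrightarrow> g z"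
proof -
  have "OL.MCauchy f"
    using f_in_X lim by (intro OL.convergent_imp_MCauchy) auto
  then have "g = (\<lambda>z. lim (\<lambda>n. f n z))"
    using OL.limitin_metric_unique[OF lim MCauchy_imp_limitin_lim] by simp
  then show ?thesis
    using MCauchy_imp_pointwise_tendsto_lim[OF \<open>OL.MCauchy f\<close> \<open>z \<in> \<Omega>\<close>] by simp
qed

end

section \<open>Generic functions avoid countably many spaces\<close>

lemma (in Metric_space) Baire_dense_gdelta_Diff:
  assumes "mcomplete" "countable \<V>"
    and nowhere_dense: "\<And>V. V \<in> \<V> \<Longrightarrow> closedin mtopology V" "\<And>V. V \<in> \<V> \<Longrightarrow> mtopology interior_of V = {}"
  shows "mtopology closure_of (M - \<Union>\<V>) = M" and "gdelta_in mtopology (M - \<Union>\<V>)"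
proof -
  have "mtopology interior_of \<Union>\<V> = {}"
    using assms by (intro metric_Baire_category_alt conjI)
  then show "mtopology closure_of (M - \<Union>\<V>) = M"
    using closure_of_complement[of mtopology "\<Union>\<V>"] by simp
  have "fsigma_in mtopology (\<Union>\<V>)"
    using \<open>countable \<V>\<close> nowhere_dense(1) by (intro fsigma_in_Union closed_imp_fsigma_in)
  then show "gdelta_in mtopology (M - \<Union>\<V>)"
    using gdelta_in_diff[OF gdelta_in_topspace] by (metis topspace_mtopology)
qed

context OL_metric_space
begin

definition OLq_sublevel :: "ereal \<Rightarrow> (complex^'n) set \<Rightarrow> nat \<Rightarrow> (complex^'n \<Rightarrow> complex) set" where
  "OLq_sublevel r D M = {g \<in> X. Lq_size r D g \<le> of_nat M}"

lemma OLq_iff_sublevel: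
  assumes "g \<in> X" "D \<subseteq> \<Omega>"
  shows "OLq r D g \<longleftrightarrow> (\<exists>M. g \<in> OLq_sublevel r D M)"
proof -
  have "Lq_size r D g < \<infinity> \<longleftrightarrow> (\<exists>M::nat. Lq_size r D g \<le> of_nat M)"
    using ennreal_Ex_less_of_nat of_nat_less_top
    by (metis infinity_ennreal_def le_less_trans less_imp_le)
  then show ?thesis
    using assms holo_on_subset[OF OL_space_imp_holo_on]
    by (simp add: OLq_iff_Lq_size OLq_sublevel_def)
qed

lemma closedin_OLq_sublevel:
  assumes "open D" "D \<subseteq> \<Omega>" "1 \<le> r"
  shows "closedin OL.mtopology (OLq_sublevel r D M)"
  unfolding OL.metric_closedin_iff_sequentially_closed
proof (intro conjI allI impI)
  fix f g assume "range f \<subseteq> OLq_sublevel r D M \<and> limitin OL.mtopology f g sequentially"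
  then have sublevel_f: "\<And>n. f n \<in> X" "\<And>n. Lq_size r D (f n) \<le> of_nat M"
    and lim_f: "limitin OL.mtopology f g sequentially"
    by (auto simp: OLq_sublevel_def)
  have "Lq_size r D g \<le> of_nat M"
  proof (rule Lq_size_limit_le)
    show "set_borel_measurable borel D (f n)" for n
      using assms sublevel_f(1)
      by (meson OL_space_imp_holo_on holo_on_imp_set_borel_measurable holo_on_subset)
    show "(\<lambda>n. f n z) \<longlonglongrightarrow> g z" if "z \<in> D" for z
      using that \<open>D \<subseteq> \<Omega>\<close> by (intro limitin_OL_imp_pointwise sublevel_f(1) lim_f) auto
  qed (use sublevel_f(2) \<open>1 \<le> r\<close> in auto)
  moreover have "g \<in> X"
    using limitin_topspace[OF lim_f] by simp
  ultimately show "g \<in> OLq_sublevel r D M" by (simp add: OLq_sublevel_def)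
qed (auto simp: OLq_sublevel_def)

lemma limitin_OL_perturbation:
  assumes "f \<in> X" "g \<in> X"
  shows "limitin OL.mtopology (\<lambda>n z. g z + of_real (inverse (real (Suc n))) * f z) g sequentially"
proof (rule limitin_OLI)
  show "(\<lambda>z. g z + of_real (inverse (real (Suc n))) * f z) \<in> X" for n
    using assms open_\<Omega> by (intro OL_space_add OL_space_cmult)
  have measurable: "set_borel_measurable borel \<Omega> f"
    using assms open_\<Omega> by (intro holo_on_imp_set_borel_measurable OL_space_imp_holo_on)
  have "0 < pj j" for j
    using pj_ge_1[of j] by simp
  then show "(\<lambda>n. Lp_norm (pj j) \<Omega> (\<lambda>z. g z + of_real (inverse (real (Suc n))) * f z - g z))
      \<longlonglongrightarrow> 0" for j
    using tendsto_mult_left_zero[OF LIMSEQ_inverse_real_of_nat]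
    by (simp add: Lp_norm_cmult[OF measurable] del: of_real_inverse of_nat_Suc)
qed (fact \<open>g \<in> X\<close>)

lemma interior_of_OLq_sublevel_empty:
  assumes D_open_subset: "open D" "D \<subseteq> \<Omega>" and "1 \<le> r" and outside_OLq: "f \<in> X" "\<not> OLq r D f"
  shows "OL.mtopology interior_of OLq_sublevel r D M = {}"
proof (rule ccontr)
  let ?U = "OL.mtopology interior_of OLq_sublevel r D M"
  assume "?U \<noteq> {}"
  then obtain g where g_interior: "g \<in> ?U" by blast
  have interior_sub: "?U \<subseteq> OLq_sublevel r D M" "OLq_sublevel r D M \<subseteq> X"
    by (auto simp: interior_of_subset OLq_sublevel_def)
  define h where "h = (\<lambda>n z. g z + of_real (inverse (real (Suc n))) * f z)"
  have "limitin OL.mtopology h g sequentially"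
    unfolding h_def using outside_OLq(1) g_interior interior_sub
    by (intro limitin_OL_perturbation) auto
  then have "\<forall>\<^sub>F n in sequentially. h n \<in> ?U"
    using g_interior by (simp add: limitin_def)
  then obtain n where h_n_interior: "h n \<in> ?U"
    by (auto simp: eventually_sequentially)
  have "OLq r D g" "OLq r D (h n)"
    using g_interior h_n_interior interior_sub OLq_iff_sublevel[OF _ D_open_subset(2)] by blast+
  then have "OLq r D (\<lambda>z. of_nat (Suc n) * (h n z + -1 * g z))"
    using D_open_subset(1) \<open>1 \<le> r\<close> by (intro OLq_cmult OLq_add)
  also have "(\<lambda>z. of_nat (Suc n) * (h n z + -1 * g z)) = f"
    by (simp add: h_def field_simps del: of_nat_Suc)
  finally show False using outside_OLq(2) by contradiction
qed

lemma dense_gdelta_not_OLq: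
  assumes "countable \<C>"
    and conditions: "\<And>r D. (r, D) \<in> \<C> \<Longrightarrow> 1 \<le> r \<and> open D \<and> D \<subseteq> \<Omega> \<and> (\<exists>f\<in>X. \<not> OLq r D f)"
  shows "OL.mtopology closure_of {g \<in> X. \<forall>(r, D)\<in>\<C>. \<not> OLq r D g} = X"
    and "gdelta_in OL.mtopology {g \<in> X. \<forall>(r, D)\<in>\<C>. \<not> OLq r D g}"
proof -
  define \<V> where "\<V> = (\<lambda>((r, D), M). OLq_sublevel r D M) ` (\<C> \<times> UNIV)"
  have "countable \<V>"
    using \<open>countable \<C>\<close> by (simp add: \<V>_def)
  moreover have "closedin OL.mtopology V \<and> OL.mtopology interior_of V = {}" if "V \<in> \<V>" for V
  proof -
    obtain r D M where "(r, D) \<in> \<C>" "V = OLq_sublevel r D M"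
      using \<open>V \<in> \<V>\<close> by (auto simp: \<V>_def)
    then show ?thesis
      using conditions[of r D] closedin_OLq_sublevel interior_of_OLq_sublevel_empty by blast
  qed
  ultimately have "OL.mtopology closure_of (X - \<Union>\<V>) = X" "gdelta_in OL.mtopology (X - \<Union>\<V>)"
    using OL.Baire_dense_gdelta_Diff[OF mcomplete_OL] by simp_all
  moreover have "g \<in> \<Union>\<V> \<longleftrightarrow> (\<exists>(r, D)\<in>\<C>. OLq r D g)" if "g \<in> X" for g
  proof -
    have "g \<in> \<Union>\<V> \<longleftrightarrow> (\<exists>c\<in>\<C>. \<exists>M. g \<in> OLq_sublevel (fst c) (snd c) M)"
      unfolding \<V>_def by force
    also have "\<dots> \<longleftrightarrow> (\<exists>c\<in>\<C>. OLq (fst c) (snd c) g)"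
      using OLq_iff_sublevel[OF \<open>g \<in> X\<close>] conditions by (intro bex_cong refl) auto
    finally show ?thesis by (simp add: case_prod_unfold)
  qed
  then have "X - \<Union>\<V> = {g \<in> X. \<forall>(r, D)\<in>\<C>. \<not> OLq r D g}" by auto
  ultimately show "OL.mtopology closure_of {g \<in> X. \<forall>(r, D)\<in>\<C>. \<not> OLq r D g} = X"
    and "gdelta_in OL.mtopology {g \<in> X. \<forall>(r, D)\<in>\<C>. \<not> OLq r D g}"
    by simp_all
qed

end

section \<open>Singular behaviour at the boundary\<close>

definition ball_base :: "'a::metric_space set \<Rightarrow> 'a set set \<Rightarrow> bool" where
  "ball_base S \<B> \<longleftrightarrow> (\<forall>B\<in>\<B>. \<exists>x\<in>S. \<exists>e>0. B = ball x e) \<and>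
    (\<forall>x\<in>S. \<forall>e>0. \<exists>B\<in>\<B>. x \<in> B \<and> B \<subseteq> ball x e)"

lemma ball_baseE:
  assumes "ball_base S \<B>" "B \<in> \<B>"
  obtains x e where "x \<in> S" "0 < e" "B = ball x e"
proof -
  have "\<exists>x\<in>S. \<exists>e>0. B = ball x e"
    using assms by (simp add: ball_base_def)
  then show ?thesis using that by blast
qed

lemma ball_base_refine:
  assumes "ball_base S \<B>" "open U" "x \<in> S" "x \<in> U"
  obtains B where "B \<in> \<B>" "x \<in> B" "B \<subseteq> U"
proof -
  obtain e where "0 < e" "ball x e \<subseteq> U"
    using \<open>open U\<close> \<open>x \<in> U\<close> open_contains_ball by blast
  moreover have "\<forall>e>0. \<exists>B\<in>\<B>. x \<in> B \<and> B \<subseteq> ball x e"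
    using assms(1,3) by (simp add: ball_base_def)
  ultimately obtain B where "B \<in> \<B>" "x \<in> B" "B \<subseteq> ball x e"
    by blast
  then show ?thesis
    using that \<open>ball x e \<subseteq> U\<close> by blast
qed

lemma countable_ball_base_exists:
  fixes S :: "'a::{metric_space, second_countable_topology} set"
  obtains \<B> where "countable \<B>" "ball_base S \<B>"
proof -
  obtain T where dense_T: "countable T" "T \<subseteq> S" "S \<subseteq> closure T"
    using separable by blast
  define r where "r = (\<lambda>n. inverse (real (Suc n)))"
  define \<B> where "\<B> = (\<lambda>(t, n). ball t (r n)) ` (T \<times> UNIV)"
  have r_pos: "0 < r n" for n by (simp add: r_def)
  have "\<exists>x\<in>S. \<exists>e>0. B = ball x e" if "B \<in> \<B>" for B
  proof -
    obtain t n where "t \<in> T" "B = ball t (r n)"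
      using \<open>B \<in> \<B>\<close> by (auto simp: \<B>_def)
    with dense_T(2) r_pos[of n] show ?thesis by blast
  qed
  moreover have "\<exists>B\<in>\<B>. x \<in> B \<and> B \<subseteq> ball x e" if "x \<in> S" "0 < e" for x e
  proof -
    obtain n where r_small: "r n < e / 2"
      unfolding r_def using reals_Archimedean[of "e / 2"] \<open>0 < e\<close> by auto
    obtain t where t_near: "t \<in> T" "dist t x < r n"
      using dense_T(3) \<open>x \<in> S\<close> r_pos[of n] by (metis closure_approachable subsetD)
    have "ball t (r n) \<subseteq> ball x e"
    proof
      fix y assume "y \<in> ball t (r n)"
      then show "y \<in> ball x e"
        using r_small t_near(2) dist_triangle[of x y t] by (simp add: dist_commute)
    qed
    moreover have "ball t (r n) \<in> \<B>" "x \<in> ball t (r n)"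
      using t_near by (auto simp: \<B>_def)
    ultimately show ?thesis by blast
  qed
  ultimately have "ball_base S \<B>"
    unfolding ball_base_def by blast
  moreover have "countable \<B>"
    using dense_T(1) by (simp add: \<B>_def)
  ultimately show ?thesis using that by blast
qed

lemma component_closure_meets_frontier:
  fixes S :: "'a::euclidean_space set"
  assumes "open S" "open B" "connected B" "B \<inter> frontier S \<noteq> {}" "E \<in> components (B \<inter> S)"
  obtains \<zeta> where "\<zeta> \<in> closure E" "\<zeta> \<in> B" "\<zeta> \<in> frontier S"
proof -
  have E_sub: "E \<subseteq> B \<inter> S" "E \<noteq> {}" "open E"
    using assms in_components_subset in_components_nonempty open_components[of "B \<inter> S"] by blast+
  have "B \<inter> frontier E \<noteq> {}"
  proof (rule connected_Int_frontier[OF \<open>connected B\<close>])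
    show "B \<inter> E \<noteq> {}" using E_sub by blast
    show "B - E \<noteq> {}"
      using assms(1,4) E_sub(1) by (auto simp: frontier_def interior_open)
  qed
  then obtain \<zeta> where zeta_frontier: "\<zeta> \<in> B" "\<zeta> \<in> closure E" "\<zeta> \<notin> E"
    using E_sub(3) by (auto simp: frontier_def interior_open)
  have "\<zeta> \<notin> S"
  proof
    assume "\<zeta> \<in> S"
    obtain T where closed_T: "closed T" "E = B \<inter> S \<inter> T"
      using closedin_component[OF assms(5)] by (auto simp: closedin_closed)
    then have "closure E \<subseteq> T" by (simp add: closure_minimal)
    then show False using zeta_frontier closed_T \<open>\<zeta> \<in> S\<close> by auto
  qed
  moreover have "\<zeta> \<in> closure S" using zeta_frontier(2) E_sub(1) closure_mono[of E S] by blast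
  ultimately show ?thesis
    using that zeta_frontier \<open>open S\<close> by (auto simp: frontier_def interior_open)
qed

lemma component_contains_component:
  fixes S :: "'a::topological_space set"
  assumes "E \<in> components (B \<inter> S)" "\<zeta> \<in> closure E" "\<zeta> \<in> B'" "open B'" "B' \<subseteq> B"
  obtains E' where "E' \<in> components (B' \<inter> S)" "E' \<subseteq> E"
proof -
  obtain x where x_in_E: "x \<in> E" "x \<in> B'"
    using assms(2-4) closure_iff_nhds_not_empty[of \<zeta> E] by blast
  then have "x \<in> B' \<inter> S" using in_components_subset[OF assms(1)] by blast
  then obtain E' where component_E': "E' \<in> components (B' \<inter> S)" "x \<in> E'"
    by (metis Union_components UnionE)
  have "E' \<subseteq> E"
    by (rule components_maximal[OF assms(1)])
      (use component_E' x_in_E in_components_subset[OF component_E'(1)]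
        in_components_connected[OF component_E'(1)] assms(5) in auto)
  with component_E'(1) show ?thesis using that by blast
qed

lemma countable_components_open:
  fixes S :: "'a::euclidean_space set"
  assumes "open S"
  shows "countable (components S)"
  using open_components[OF assms] pairwise_disjoint_components[of S]
  by (intro countable_disjoint_open_subsets) (auto simp: pairwise_def disjnt_def)

lemma unbounded_image_of_blow_up:
  assumes "filterlim f at_infinity (at \<zeta> within S)" "E \<subseteq> S" "\<zeta> \<in> closure E" "\<zeta> \<notin> E"
  shows "\<not> bounded (f ` E)"
proof
  assume "bounded (f ` E)"
  then obtain b where bound: "0 < b" "\<And>z. z \<in> E \<Longrightarrow> norm (f z) < b"
    by (auto simp: bounded_pos_less)
  have "filterlim f at_infinity (at \<zeta> within E)"
    using assms(1) at_le[OF assms(2)] by (rule filterlim_mono[OF _ order_refl])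
  then have "\<forall>\<^sub>F z in at \<zeta> within E. b \<le> norm (f z)"
    using bound(1) filterlim_at_infinity[of 0] by auto
  moreover have "\<forall>\<^sub>F z in at \<zeta> within E. z \<in> E"
    by (simp add: eventually_at_filter)
  ultimately have "\<forall>\<^sub>F z in at \<zeta> within E. False"
    by eventually_elim (use bound(2) in force)
  then have "at \<zeta> within E = bot" by (simp add: trivial_limit_def)
  then show False
    using assms(3,4) by (simp add: trivial_limit_within closure_def)
qed

definition singular_at ::
  "ereal \<Rightarrow> (complex^'n) set \<Rightarrow> complex^'n \<Rightarrow> (complex^'n \<Rightarrow> complex) \<Rightarrow> bool" where
  "singular_at q \<Omega> \<zeta> f \<longleftrightarrow>
    (\<forall>\<epsilon>>0. \<not> OLq q (ball \<zeta> \<epsilon> \<inter> \<Omega>) f) \<and> filterlim f at_infinity (at \<zeta> within \<Omega>)"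

lemma singular_at_in_OL_space:
  assumes "open \<Omega>" "OL_below q \<Omega> f" "singular_at q \<Omega> \<zeta> f"
  obtains g where "g \<in> OL_space q \<Omega>" "singular_at q \<Omega> \<zeta> g"
proof (rule that)
  define g where "g = (\<lambda>z. if z \<in> \<Omega> then f z else 0)"
  have g_eq: "f z = g z" if "z \<in> \<Omega>" for z using that by (simp add: g_def)
  show "g \<in> OL_space q \<Omega>"
    using assms(2) OL_cong[OF \<open>open \<Omega>\<close> g_eq] by (simp add: OL_space_def OL_below_def g_def)
  have "OLq q (ball \<zeta> \<epsilon> \<inter> \<Omega>) f \<longleftrightarrow> OLq q (ball \<zeta> \<epsilon> \<inter> \<Omega>) g" for \<epsilon>
    using \<open>open \<Omega>\<close> g_eq by (intro OLq_cong) auto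
  moreover have "\<forall>\<^sub>F z in at \<zeta> within \<Omega>. f z = g z"
    by (auto simp: eventually_at_filter g_eq)
  then have "filterlim f at_infinity (at \<zeta> within \<Omega>) \<longleftrightarrow> filterlim g at_infinity (at \<zeta> within \<Omega>)"
    by (intro filterlim_cong refl)
  ultimately show "singular_at q \<Omega> \<zeta> g"
    using assms(3) by (simp add: singular_at_def)
qed

lemma totally_unbounded_iff_ball_base:
  assumes "open \<Omega>" and base: "ball_base (frontier \<Omega>) \<B>"
  shows "totally_unbounded g \<Omega> \<longleftrightarrow> (\<forall>B\<in>\<B>. \<forall>E\<in>components (B \<inter> \<Omega>). \<not> bounded (g ` E))"
proof
  assume "totally_unbounded g \<Omega>"
  then show "\<forall>B\<in>\<B>. \<forall>E\<in>components (B \<inter> \<Omega>). \<not> bounded (g ` E)"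
    unfolding totally_unbounded_def by (metis ball_baseE[OF base])
next
  assume unbounded: "\<forall>B\<in>\<B>. \<forall>E\<in>components (B \<inter> \<Omega>). \<not> bounded (g ` E)"
  show "totally_unbounded g \<Omega>"
    unfolding totally_unbounded_def
  proof (intro ballI allI impI)
    fix w \<delta> E assume boundary_ball: "w \<in> frontier \<Omega>" "0 < \<delta>"
      and component_E: "E \<in> components (ball w \<delta> \<inter> \<Omega>)"
    have "ball w \<delta> \<inter> frontier \<Omega> \<noteq> {}" using boundary_ball centre_in_ball by blast
    then obtain \<zeta> where zeta_frontier: "\<zeta> \<in> closure E" "\<zeta> \<in> ball w \<delta>" "\<zeta> \<in> frontier \<Omega>"
      using component_closure_meets_frontier[OF \<open>open \<Omega>\<close> open_ball connected_ball _ component_E]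
      by blast
    obtain B where base_ball: "B \<in> \<B>" "\<zeta> \<in> B" "B \<subseteq> ball w \<delta>"
      using ball_base_refine[OF base open_ball zeta_frontier(3,2)] .
    have "open B" using ball_baseE[OF base base_ball(1)] open_ball by metis
    then obtain E' where "E' \<in> components (B \<inter> \<Omega>)" "E' \<subseteq> E"
      using component_contains_component[OF component_E zeta_frontier(1) base_ball(2) _ base_ball(3)]
      by blast
    with unbounded base_ball(1) show "\<not> bounded (g ` E)"
      by (meson bounded_subset image_mono)
  qed
qed

lemma nowhere_OLq_iff_ball_base:
  assumes base: "ball_base (frontier \<Omega>) \<B>"
  shows "(\<forall>\<zeta>\<in>frontier \<Omega>. \<forall>\<epsilon>>0. \<not> OLq q (ball \<zeta> \<epsilon> \<inter> \<Omega>) g) \<longleftrightarrow> (\<forall>B\<in>\<B>. \<not> OLq q (B \<inter> \<Omega>) g)"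
proof
  assume "\<forall>\<zeta>\<in>frontier \<Omega>. \<forall>\<epsilon>>0. \<not> OLq q (ball \<zeta> \<epsilon> \<inter> \<Omega>) g"
  then show "\<forall>B\<in>\<B>. \<not> OLq q (B \<inter> \<Omega>) g"
    by (metis ball_baseE[OF base])
next
  assume not_OLq: "\<forall>B\<in>\<B>. \<not> OLq q (B \<inter> \<Omega>) g"
  show "\<forall>\<zeta>\<in>frontier \<Omega>. \<forall>\<epsilon>>0. \<not> OLq q (ball \<zeta> \<epsilon> \<inter> \<Omega>) g"
  proof (intro ballI allI impI)
    fix \<zeta> \<epsilon> assume "\<zeta> \<in> frontier \<Omega>" "0 < (\<epsilon>::real)"
    then obtain B where "B \<in> \<B>" "B \<subseteq> ball \<zeta> \<epsilon>"
      using ball_base_refine[OF base open_ball] centre_in_ball by metis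
    then have "OLq q (ball \<zeta> \<epsilon> \<inter> \<Omega>) g \<Longrightarrow> OLq q (B \<inter> \<Omega>) g"
      by (elim OLq_subset) blast
    with not_OLq \<open>B \<in> \<B>\<close> show "\<not> OLq q (ball \<zeta> \<epsilon> \<inter> \<Omega>) g" by blast
  qed
qed

text \<open>A pair \<open>(r, D)\<close> stands for the condition not to be of class \<open>L\<^sup>r\<close> on \<open>D\<close>; for
  \<open>r = \<infinity>\<close> this means to be unbounded on \<open>D\<close>.\<close>

definition boundary_conditions ::
  "ereal \<Rightarrow> (complex^'n) set \<Rightarrow> (complex^'n) set set \<Rightarrow> (ereal \<times> (complex^'n) set) set" where
  "boundary_conditions q \<Omega> \<B> =
    (\<Union>B\<in>\<B>. Pair \<infinity> ` components (B \<inter> \<Omega>)) \<union> (\<lambda>B. (q, B \<inter> \<Omega>)) ` \<B>"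

lemma countable_boundary_conditions:
  assumes "open \<Omega>" "countable \<B>" "ball_base (frontier \<Omega>) \<B>"
  shows "countable (boundary_conditions q \<Omega> \<B>)"
proof -
  have "countable (components (B \<inter> \<Omega>))" if "B \<in> \<B>" for B
    using assms that by (metis ball_baseE countable_components_open open_Int open_ball)
  then show ?thesis
    using \<open>countable \<B>\<close> by (simp add: boundary_conditions_def)
qed

context OL_metric_space
begin

lemma avoids_boundary_conditions_iff:
  assumes base: "ball_base (frontier \<Omega>) \<B>" and g_in_X: "g \<in> X"
  shows "(\<forall>(r, D)\<in>boundary_conditions q \<Omega> \<B>. \<not> OLq r D g) \<longleftrightarrow>
    totally_unbounded g \<Omega> \<and> (\<forall>\<zeta>\<in>frontier \<Omega>. \<forall>\<epsilon>>0. \<not> OLq q (ball \<zeta> \<epsilon> \<inter> \<Omega>) g)"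
proof -
  have "OLq \<infinity> E g \<longleftrightarrow> bounded (g ` E)" if "E \<in> components (B \<inter> \<Omega>)" for B E
    using holo_on_subset[OF OL_space_imp_holo_on[OF g_in_X]] in_components_subset[OF that]
    by (simp add: OLq_def OL_inf_def)
  then have "totally_unbounded g \<Omega> \<longleftrightarrow> (\<forall>B\<in>\<B>. \<forall>E\<in>components (B \<inter> \<Omega>). \<not> OLq \<infinity> E g)"
    by (simp add: totally_unbounded_iff_ball_base[OF open_\<Omega> base])
  then show ?thesis
    by (simp add: nowhere_OLq_iff_ball_base[OF base] boundary_conditions_def ball_Un)
qed

lemma unbounded_function_on_component:
  assumes "w \<in> frontier \<Omega>" "0 < e" and component: "E \<in> components (ball w e \<inter> \<Omega>)"
    and singular: "\<And>\<zeta>. \<zeta> \<in> frontier \<Omega> \<Longrightarrow> \<exists>f\<in>X. singular_at q \<Omega> \<zeta> f"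
  shows "\<exists>f\<in>X. \<not> bounded (f ` E)"
proof -
  have "ball w e \<inter> frontier \<Omega> \<noteq> {}"
    using assms(1,2) centre_in_ball by blast
  then obtain \<zeta> where "\<zeta> \<in> closure E" "\<zeta> \<in> frontier \<Omega>"
    using component_closure_meets_frontier[OF open_\<Omega> open_ball connected_ball _ component] by blast
  obtain f where "f \<in> X" "filterlim f at_infinity (at \<zeta> within \<Omega>)"
    using singular[OF \<open>\<zeta> \<in> frontier \<Omega>\<close>] unfolding singular_at_def by blast
  have "E \<subseteq> \<Omega>"
    using in_components_subset[OF component] by blast
  then have "\<zeta> \<notin> E"
    using \<open>\<zeta> \<in> frontier \<Omega>\<close> open_\<Omega> by (auto simp: frontier_def interior_open)
  then have "\<not> bounded (f ` E)"
    using \<open>filterlim f at_infinity (at \<zeta> within \<Omega>)\<close> \<open>E \<subseteq> \<Omega>\<close> \<open>\<zeta> \<in> closure E\<close>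
    by (intro unbounded_image_of_blow_up)
  with \<open>f \<in> X\<close> show ?thesis by blast
qed

lemma boundary_condition_nontrivial:
  assumes base: "ball_base (frontier \<Omega>) \<B>"
    and singular: "\<And>\<zeta>. \<zeta> \<in> frontier \<Omega> \<Longrightarrow> \<exists>f\<in>X. singular_at q \<Omega> \<zeta> f"
    and condition: "(r, D) \<in> boundary_conditions q \<Omega> \<B>"
  shows "1 \<le> r \<and> open D \<and> D \<subseteq> \<Omega> \<and> (\<exists>f\<in>X. \<not> OLq r D f)"
proof -
  obtain B where "B \<in> \<B>" and D_cases: "D \<in> components (B \<inter> \<Omega>) \<and> r = \<infinity> \<or> D = B \<inter> \<Omega> \<and> r = q"
    using condition by (auto simp: boundary_conditions_def)
  obtain \<zeta> e where zeta: "\<zeta> \<in> frontier \<Omega>" "0 < e" and B_eq: "B = ball \<zeta> e"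
    using base \<open>B \<in> \<B>\<close> by (rule ball_baseE)
  have "open (B \<inter> \<Omega>)"
    using open_\<Omega> by (simp add: B_eq open_Int)
  from D_cases show ?thesis
  proof (elim disjE conjE)
    assume component: "D \<in> components (B \<inter> \<Omega>)" and "r = \<infinity>"
    have "open D" "D \<subseteq> \<Omega>"
      using open_components[OF \<open>open (B \<inter> \<Omega>)\<close> component] in_components_subset[OF component] by auto
    moreover have "\<exists>f\<in>X. \<not> bounded (f ` D)"
      using unbounded_function_on_component[OF zeta _ singular] component B_eq by blast
    ultimately show ?thesis
      using \<open>r = \<infinity>\<close> by (auto simp: OLq_def OL_inf_def)
  next
    assume "D = B \<inter> \<Omega>" "r = q"
    moreover have "\<exists>f\<in>X. \<not> OLq q (B \<inter> \<Omega>) f"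
      using singular[OF zeta(1)] zeta(2) by (auto simp: singular_at_def B_eq)
    ultimately show ?thesis
      using \<open>open (B \<inter> \<Omega>)\<close> q_gt_1 by auto
  qed
qed

end

theorem theorem8:
  fixes \<Omega> :: "(complex^'n) set" and q :: ereal and pj :: "nat \<Rightarrow> real"
  assumes "bounded \<Omega>" and "open \<Omega>"
    and "1 < q"
    and "strict_mono pj" and "1 < pj 0" and "\<And>j. ereal (pj j) < q"
    and "(\<lambda>j. ereal (pj j)) \<longlonglongrightarrow> q"
    and "\<forall>\<zeta>\<in>frontier \<Omega>. \<exists>f. OL_below q \<Omega> f
           \<and> (\<forall>\<epsilon>>0. \<not> OLq q (ball \<zeta> \<epsilon> \<inter> \<Omega>) f)
           \<and> filterlim f at_infinity (at \<zeta> within \<Omega>)"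
  shows "Metric_space.mtopology (OL_space q \<Omega>) (OL_dist pj \<Omega>) closure_of
           {g \<in> OL_space q \<Omega>. totally_unbounded g \<Omega>
              \<and> (\<forall>\<zeta>\<in>frontier \<Omega>. \<forall>\<epsilon>>0. \<not> OLq q (ball \<zeta> \<epsilon> \<inter> \<Omega>) g)}
         = OL_space q \<Omega>
       \<and> gdelta_in (Metric_space.mtopology (OL_space q \<Omega>) (OL_dist pj \<Omega>))
           {g \<in> OL_space q \<Omega>. totally_unbounded g \<Omega>
              \<and> (\<forall>\<zeta>\<in>frontier \<Omega>. \<forall>\<epsilon>>0. \<not> OLq q (ball \<zeta> \<epsilon> \<inter> \<Omega>) g)}"
proof -
  have "1 \<le> pj j" for j
    using assms(5) strict_mono_less_eq[OF assms(4), of 0 j] by simp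
  then interpret OL_metric_space \<Omega> q pj
    using assms by unfold_locales
  obtain \<B> where base: "countable \<B>" "ball_base (frontier \<Omega>) \<B>"
    by (rule countable_ball_base_exists)
  have singular: "\<exists>f\<in>X. singular_at q \<Omega> \<zeta> f" if "\<zeta> \<in> frontier \<Omega>" for \<zeta>
    using assms(8) that singular_at_in_OL_space[OF open_\<Omega>] by (metis singular_at_def)
  let ?C = "boundary_conditions q \<Omega> \<B>"
  have "{g \<in> X. \<forall>(r, D)\<in>?C. \<not> OLq r D g} =
      {g \<in> X. totally_unbounded g \<Omega> \<and> (\<forall>\<zeta>\<in>frontier \<Omega>. \<forall>\<epsilon>>0. \<not> OLq q (ball \<zeta> \<epsilon> \<inter> \<Omega>) g)}"
    using avoids_boundary_conditions_iff[OF base(2)] by blast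
  moreover have "countable ?C"
    using open_\<Omega> base by (rule countable_boundary_conditions)
  ultimately show ?thesis
    using dense_gdelta_not_OLq[of ?C, OF _ boundary_condition_nontrivial[OF base(2) singular]]
    by simp
qed

end
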